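(* Let $\rho_n$ ($n\ge 2$) be the maximal radius of the symmetric collection $\mathcal{B}_n(r)$ of $n$ congruent disks of radius $r$ centered at the $n$th roots of unity. Then $\rho_2=\sqrt{2}$, $\rho_3=1$, and for every $n\geq 4$ $$\rho_n=\sqrt{1+\mu_n},$$ where $\mu_n$ denotes the smallest zero different from $-1$ of the hypergeometric polynomial $$z^{\nu} F\left(-\nu,\nu-n;1-n;-\frac{1}{z}\right),\qquad \nu=[n/2].$$ Furthermore, $$\lim_{n\to\infty}n\rho_n=j_{1,1},$$ where $j_{1,1}=3.831706\ldots$ is the first positive zero of the Bessel function of the first kind $J_1$.
   Context: For $n\ge 2$ put $\omega=e^{2\pi \mathrm{i}/n}$. For $r>0$, $\mathcal{B}_n(r)=\{B(\omega^j,r): j=1,\ldots,n\}$ is the collection of the $n$ open disks of radius $r$ centered at $\omega^j$. The associated Hermitian $n\times n$ matrix $Q(r)$ has entries $$Q_{ij}(r)=-\prod_{k=1}^n\left[(\omega^i-\omega^k)\overline{(\omega^j-\omega^k)}-r^2\right].$$ $\mathcal{B}_n(r)$ is called positive if $Q(r)$ is positive definite. The maximal radius is $$\rho_n=\sup\{\rho>0 \mid \mathcal{B}_n(r)\text{ is positive for all } r\in(0,\rho)\}.$$ $[x]$ denotes the integer part. $F(a,b;c;x)=1+\sum_{k\ge 1}\frac{(a)_k(b)_k}{(c)_k}\frac{x^k}{k!}$ is the Gauss hypergeometric function, with $(a)_0=1$, $(a)_k=a(a+1)\cdots(a+k-1)$; here it is a terminating series, so that $$z^{\nu}F\left(-\nu,\nu-n;1-n;-\tfrac1z\right)=\sum_{k=0}^{\nu}\frac{(-\nu)_k(\nu-n)_k}{(1-n)_k\,k!}(-1)^kz^{\nu-k}.$$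 The Bessel function is $J_k(x)=\left(\frac{x}{2}\right)^k\sum_{m=0}^\infty\frac{(-1)^m(x/2)^{2m}}{m!\,\Gamma(m+k+1)}$. *)

theory Defs
  imports
    "HOL-Analysis.Gamma_Function"
    "HOL-Analysis.FPS_Convergence"
    "HOL-Library.Extended_Real"
    "Jordan_Normal_Form.Schur_Decomposition"
begin

definition pos_def_mat :: "complex mat \<Rightarrow> bool" where
  "pos_def_mat A \<longleftrightarrow>
     square_mat A \<and> mat_adjoint A = A \<and>
     (\<forall>v \<in> carrier_vec (dim_row A). v \<noteq> 0\<^sub>v (dim_row A) \<longrightarrow> 0 < Re ((A *\<^sub>v v) \<bullet>c v))"

definition root_unity :: "nat \<Rightarrow> complex" where
  "root_unity n = exp (2 * of_real pi * \<i> / of_nat n)"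

text \<open>Matrix rows and columns are numbered from 0, whereas the centers are
  \<open>\<omega>^1, \<dots>, \<omega>^n\<close>; hence the shifts by \<^const>\<open>Suc\<close>.\<close>

definition disk_matrix :: "nat \<Rightarrow> real \<Rightarrow> complex mat" where
  "disk_matrix n r =
     (let \<omega> = root_unity n in
      mat n n (\<lambda>(i, j).
        - (\<Prod>k = 1..n. ((\<omega> ^ Suc i - \<omega> ^ k) * cnj (\<omega> ^ Suc j - \<omega> ^ k) - of_real (r\<^sup>2)))))"

definition positive_collection :: "nat \<Rightarrow> real \<Rightarrow> bool" where
  "positive_collection n r \<longleftrightarrow> pos_def_mat (disk_matrix n r)"

text \<open>The supremum is taken in the extended reals, so that an equation between
  \<open>max_radius n\<close> and a positive real number also says that the set is nonempty and
  bounded above.\<close>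

definition max_radius :: "nat \<Rightarrow> ereal" where
  "max_radius n = (SUP \<rho> \<in> {\<rho>::real. \<rho> > 0 \<and> (\<forall>r \<in> {0<..<\<rho>}. positive_collection n r)}. ereal \<rho>)"

definition gauss_F :: "real \<Rightarrow> real \<Rightarrow> real \<Rightarrow> real \<Rightarrow> real" where
  "gauss_F a b c x = eval_fps (fps_hypergeo [a, b] [c] 1) x"

text \<open>The polynomial \<open>z^\<nu> F(-\<nu>, \<nu>-n; 1-n; -1/z)\<close> with \<open>\<nu> = \<lfloor>n/2\<rfloor>\<close>, multiplied out so that
  it also makes sense at \<open>z = 0\<close>; see \<open>poly_hypergeo_poly\<close> below.\<close>

definition hypergeo_poly :: "nat \<Rightarrow> real poly" where
  "hypergeo_poly n =
     (let \<nu> = n div 2 in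
      \<Sum>k\<le>\<nu>. monom (pochhammer (- real \<nu>) k * pochhammer (real \<nu> - real n) k
                  / (pochhammer (1 - real n) k * fact k) * (-1) ^ k) (\<nu> - k))"

lemma poly_hypergeo_poly:
  fixes z :: real
  assumes "z \<noteq> 0"
  shows "poly (hypergeo_poly n) z =
           z ^ (n div 2) *
           gauss_F (- real (n div 2)) (real (n div 2) - real n) (1 - real n) (- 1 / z)"
proof -
  define \<nu> where "\<nu> = n div 2"
  define c where "c k = pochhammer (- real \<nu>) k * pochhammer (real \<nu> - real n) k
                  / (pochhammer (1 - real n) k * fact k)" for k
  have c0: "c k = 0" if "k > \<nu>" for k
    using that by (simp add: c_def pochhammer_of_nat_eq_0_iff)
  have "gauss_F (- real \<nu>) (real \<nu> - real n) (1 - real n) (- 1 / z) = (\<Sum>k. c k * (- 1 / z) ^ k)"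
    by (simp add: gauss_F_def eval_fps_def c_def)
  also have "\<dots> = (\<Sum>k\<le>\<nu>. c k * (- 1 / z) ^ k)"
    by (rule suminf_finite) (auto simp: c0)
  finally have "z ^ \<nu> * gauss_F (- real \<nu>) (real \<nu> - real n) (1 - real n) (- 1 / z)
      = (\<Sum>k\<le>\<nu>. z ^ \<nu> * (c k * (- 1 / z) ^ k))"
    by (simp add: sum_distrib_left)
  also have "\<dots> = (\<Sum>k\<le>\<nu>. c k * (-1) ^ k * z ^ (\<nu> - k))"
  proof (rule sum.cong)
    fix k assume "k \<in> {..\<nu>}"
    then have "z ^ \<nu> = z ^ (\<nu> - k) * z ^ k"
      by (simp flip: power_add)
    moreover have "(- 1 / z) ^ k = (-1) ^ k / z ^ k"
      by (rule power_divide)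
    ultimately show "z ^ \<nu> * (c k * (- 1 / z) ^ k) = c k * (-1) ^ k * z ^ (\<nu> - k)"
      using assms by simp
  qed simp
  also have "\<dots> = poly (hypergeo_poly n) z"
    by (simp add: hypergeo_poly_def Let_def poly_sum poly_monom c_def \<nu>_def)
  finally show ?thesis
    by (simp add: \<nu>_def)
qed

definition bessel_J :: "nat \<Rightarrow> real \<Rightarrow> real" where
  "bessel_J k x =
     (x / 2) ^ k * (\<Sum>m. (-1) ^ m * (x / 2) ^ (2 * m) / (fact m * Gamma (real m + real k + 1)))"

definition is_smallest_zero_ne_neg1 :: "real poly \<Rightarrow> real \<Rightarrow> bool" where
  "is_smallest_zero_ne_neg1 p \<mu> \<longleftrightarrow>
     poly p \<mu> = 0 \<and> \<mu> \<noteq> -1 \<and> (\<forall>z. poly p z = 0 \<and> z \<noteq> -1 \<longrightarrow> \<mu> \<le> z)"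

definition is_first_pos_zero :: "(real \<Rightarrow> real) \<Rightarrow> real \<Rightarrow> bool" where
  "is_first_pos_zero f j \<longleftrightarrow> 0 < j \<and> f j = 0 \<and> (\<forall>x. 0 < x \<and> x < j \<longrightarrow> f x \<noteq> 0)"

end

theory Submission
  imports Defs
begin

text \<open>
  Put \<open>t = r\<^sup>2\<close>, \<open>x = \<omega>^(i - j)\<close> and choose \<open>a\<close>, \<open>b\<close> with \<open>a b = x\<close> and \<open>(1 - a) (1 - b) = t\<close>.
  Every factor of \<open>Q\<^sub>i\<^sub>j\<close> splits as \<open>-(y - a) (y - b) / y\<close> with \<open>y\<close> an \<open>n\<close>-th root of unity, so
  \<open>Q\<^sub>i\<^sub>j = (1 - a^n) (1 - b^n)\<close> and \<open>Q\<close> is circulant. Its eigenvalues are \<open>n t S\<^sub>s(t)\<close>, where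
  \<open>S\<^sub>s(t) = F(s + 1 - n, s + 1; 2; t)\<close>; re-expanded at \<open>z = t - 1\<close> these are, up to a factor,
  the hypergeometric polynomials with \<open>\<nu> = n - s\<close>. A Sturm comparison shows that, as \<open>t\<close> grows
  from 0, the eigenvalue with \<open>\<nu> = [n/2]\<close> vanishes first. Finally \<open>S\<^sub>s(4 u / n\<^sup>2)\<close> with
  \<open>s = n - [n/2]\<close> converges uniformly on bounded sets to \<open>\<Sum>(-u)^k / (k! (k + 1)!)\<close>, which is
  \<open>2 J\<^sub>1(x) / x\<close> at \<open>u = x\<^sup>2 / 4\<close>.
\<close>

section \<open>The eigenvalue polynomials\<close>

text \<open>
  \<open>S_poly s m\<close> is the polynomial \<open>F(-m, s + 1; 2; t)\<close>, up to normalisation a Jacobi polynomial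
  in \<open>1 - 2 t\<close>; the eigenvalues of \<open>Q(r)\<close> are \<open>n r\<^sup>2 S_poly s (n - 1 - s) (r\<^sup>2)\<close> for
  \<open>0 \<le> s < n\<close>. \<open>U_poly s m\<close> is the derivative of \<open>t S_poly s m\<close>.
\<close>

definition U_poly :: "nat \<Rightarrow> nat \<Rightarrow> real poly" where
  "U_poly s m = (\<Sum>k\<le>m. monom ((-1) ^ k * real (m choose k) * real (s + k choose k)) k)"

definition S_poly :: "nat \<Rightarrow> nat \<Rightarrow> real poly" where
  "S_poly s m =
     (\<Sum>k\<le>m. monom ((-1) ^ k * real (m choose k) * real (s + k choose k) / real (Suc k)) k)"

section \<open>Coefficients and recurrences of the two polynomial families\<close>

lemma coeff_sum_atMost_monom:
  "coeff (\<Sum>k\<le>m. monom (f k) k) i = (if i \<le> m then f i else (0::'a::comm_monoid_add))"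
proof -
  have "coeff (\<Sum>k\<le>m. monom (f k) k) i = (\<Sum>k\<le>m. if k = i then f k else 0)"
    by (simp add: coeff_sum coeff_monom)
  then show ?thesis
    by simp
qed

lemma coeff_U_poly: "coeff (U_poly s m) k = (-1) ^ k * real (m choose k) * real (s + k choose k)"
  by (auto simp: U_poly_def coeff_sum_atMost_monom binomial_eq_0)

lemma coeff_S_poly:
  "coeff (S_poly s m) k = (-1) ^ k * real (m choose k) * real (s + k choose k) / real (Suc k)"
  by (auto simp: S_poly_def coeff_sum_atMost_monom binomial_eq_0)

lemma U_poly_0_right [simp]: "U_poly s 0 = 1"
  by (simp add: U_poly_def monom_0 one_pCons)

text \<open>Pascal's rule in both binomial factors of a coefficient. Together with the values at
  \<open>s = 0\<close> and at \<open>m = 0\<close> it determines the whole family.\<close>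

lemma U_poly_rec:
  "U_poly (Suc s) (Suc m) = [:1, -1:] * U_poly (Suc s) m + U_poly s (Suc m) - U_poly s m"
proof (rule poly_eqI)
  fix k
  show "coeff (U_poly (Suc s) (Suc m)) k =
      coeff ([:1, -1:] * U_poly (Suc s) m + U_poly s (Suc m) - U_poly s m) k"
  proof (cases k)
    case 0
    then show ?thesis by (simp add: coeff_U_poly)
  next
    case (Suc j)
    have "real (Suc m choose Suc j) = real (m choose j) + real (m choose Suc j)"
      "real (Suc s + Suc j choose Suc j) = real (Suc s + j choose j) + real (s + Suc j choose Suc j)"
      by simp_all
    then show ?thesis
      by (simp only: Suc coeff_add coeff_diff coeff_U_poly mult_pCons_left coeff_pCons_Suc
          coeff_smult power_Suc mult_zero_left add_0_right) (simp add: coeff_U_poly algebra_simps)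
  qed
qed

lemma U_poly_0_left: "U_poly 0 m = [:1, -1:] ^ m"
proof (induction m)
  case (Suc m)
  have "U_poly 0 (Suc m) = [:1, -1:] * U_poly 0 m"
  proof (rule poly_eqI)
    fix k show "coeff (U_poly 0 (Suc m)) k = coeff ([:1, -1:] * U_poly 0 m) k"
      by (cases k) (simp_all add: coeff_U_poly algebra_simps)
  qed
  then show ?case by (simp add: Suc)
qed simp

text \<open>Absorption writes all four binomials as multiples of binomial(m, j) and binomial(s + 1 +
  j, j). With n = s + m + 2, this is where the factor n t in front of \<open>S_poly\<close> comes
  from.\<close>

lemma U_minus_U_Suc: "U_poly s m - U_poly (Suc s) (Suc m) = Polynomial.smult (real (s + m + 2)) (pCons 0 (S_poly (Suc s) m))"
proof (rule poly_eqI)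
  fix k
  show "coeff (U_poly s m - U_poly (Suc s) (Suc m)) k =
      coeff (Polynomial.smult (real (s + m + 2)) (pCons 0 (S_poly (Suc s) m))) k"
  proof (cases k)
    case 0
    then show ?thesis by (simp add: coeff_U_poly)
  next
    case (Suc j)
    have eqs: "real (Suc j) * real (Suc m choose Suc j) = real (Suc m) * real (m choose j)"
      "real (Suc j) * real (m choose Suc j) = (real m - real j) * real (m choose j)"
      "real (Suc j) * real (Suc s + Suc j choose Suc j) = (real s + real j + 2) * real (Suc s + j choose j)"
      "real (Suc j) * real (s + Suc j choose Suc j) = real (Suc s) * real (Suc s + j choose j)"
    proof -
      show "real (Suc j) * real (Suc m choose Suc j) = real (Suc m) * real (m choose j)"
        by (metis Suc_times_binomial of_nat_mult)
      have "Suc j * (m choose Suc j) = (m - j) * (m choose j)"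
        by (metis binomial_absorption binomial_absorb_comp)
      then show "real (Suc j) * real (m choose Suc j) = (real m - real j) * real (m choose j)"
        by (cases "j \<le> m") (metis of_nat_diff of_nat_mult, simp add: binomial_eq_0)
      show "real (Suc j) * real (Suc s + Suc j choose Suc j) = (real s + real j + 2) * real (Suc s + j choose j)"
      proof -
        have "Suc j * (Suc s + Suc j choose Suc j) = (s + j + 2) * (Suc s + j choose j)"
          using Suc_times_binomial[of j "Suc s + j"] by (simp del: binomial_Suc_Suc)
        then have "real (Suc j * (Suc s + Suc j choose Suc j)) = real ((s + j + 2) * (Suc s + j choose j))"
          by (rule arg_cong)
        then show ?thesis
          by (simp only: of_nat_mult of_nat_add of_nat_numeral)
      qed
      have "Suc j * (Suc s + j choose Suc j) = Suc s * (Suc s + j choose j)"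
        by (metis binomial_absorption binomial_absorb_comp add_diff_cancel_right')
      then show "real (Suc j) * real (s + Suc j choose Suc j) = real (Suc s) * real (Suc s + j choose j)"
        by (metis add_Suc_shift of_nat_mult)
    qed
    define c where "c = real (Suc j)"
    have c: "c \<noteq> 0" by (simp add: c_def)
    define x y where "x = real (m choose j)" and "y = real (Suc s + j choose j)"
    have e: "real (Suc m choose Suc j) = real (Suc m) * x / c"
      "real (m choose Suc j) = (real m - real j) * x / c"
      "real (Suc s + Suc j choose Suc j) = (real s + real j + 2) * y / c"
      "real (s + Suc j choose Suc j) = real (Suc s) * y / c"
      using eqs c by (simp_all only: flip: c_def x_def y_def) (simp_all add: field_simps)
    have j: "real j = c - 1" by (simp add: c_def)
    have "coeff (U_poly s m - U_poly (Suc s) (Suc m)) (Suc j) =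
       (-1) ^ j * (real (Suc m choose Suc j) * real (Suc s + Suc j choose Suc j)
        - real (m choose Suc j) * real (s + Suc j choose Suc j))"
      by (simp only: coeff_diff coeff_U_poly power_Suc) (simp add: algebra_simps)
    \<comment> \<open>(m + 1) (s + j + 2) - (m - j) (s + 1) = (s + m + 2) (j + 1), which cancels one
      of the two denominators c = j + 1.\<close>
    also have "\<dots> = (-1) ^ j * ((s + m + 2) * x * y / c)"
      unfolding e j using c by (simp add: field_simps)
    also have "\<dots> = coeff (Polynomial.smult (real (s + m + 2)) (pCons 0 (S_poly (Suc s) m))) (Suc j)"
      by (simp only: coeff_smult coeff_pCons_Suc coeff_S_poly flip: c_def x_def y_def) simp
    finally show ?thesis using Suc by simp
  qed
qed

text \<open>Formally the case s = -1 of \<open>U_minus_U_Suc\<close>: binomial(k - 1, k) vanishes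
  for k > 0, which reduces the first polynomial there to 1.\<close>

lemma one_minus_U_poly: "1 - U_poly 0 (Suc m) = Polynomial.smult (real (Suc m)) (pCons 0 (S_poly 0 m))"
proof (rule poly_eqI)
  fix k
  show "coeff (1 - U_poly 0 (Suc m)) k = coeff (Polynomial.smult (real (Suc m)) (pCons 0 (S_poly 0 m))) k"
  proof (cases k)
    case (Suc j)
    have "real (Suc j) * real (Suc m choose Suc j) = real (Suc m) * real (m choose j)"
      by (metis Suc_times_binomial of_nat_mult)
    then have "real (Suc m choose Suc j) = real (Suc m) * real (m choose j) / real (Suc j)"
      by (simp add: field_simps)
    then show ?thesis
      by (simp only: Suc coeff_diff coeff_U_poly coeff_smult coeff_pCons_Suc coeff_S_poly power_Suc)
        simp
  qed (simp add: coeff_U_poly)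
qed

lemma pderiv_U: "pderiv (pCons 0 (S_poly s m)) = U_poly s m"
  by (rule poly_eqI) (simp add: coeff_pderiv coeff_U_poly coeff_S_poly del: of_nat_Suc)

text \<open>Both sides satisfy the recurrence \<open>U_poly_rec\<close>.\<close>

lemma U_poly_shift:
  "poly (U_poly s m) (1 + z) =
     (-1) ^ m * (\<Sum>k\<le>m. real (s choose k) * real (s + m - k choose s) * z ^ (m - k))"
proof (induction s arbitrary: m)
  case 0
  have "(\<Sum>k\<le>m. real (0 choose k) * real (0 + m - k choose 0) * z ^ (m - k)) = z ^ m"
    by (subst sum.atMost_shift) simp
  then show ?case
    by (simp add: U_poly_0_left power_minus')
next
  case (Suc s)
  note IH = this
  show ?case
  proof (induction m)
    case 0
    show ?case by simp
  next
    case (Suc m)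
    define a where "a k = real (Suc s choose k) * real (Suc s + m - k choose Suc s)" for k
    define b where "b k = real (s choose k) * real (s + Suc m - k choose s)" for k
    define c where "c k = real (s choose k) * real (s + m - k choose s)" for k
    define d where "d k = real (Suc s choose k) * real (Suc s + Suc m - k choose Suc s)" for k
    have A: "poly (U_poly (Suc s) m) (1 + z) = (-1) ^ m * (\<Sum>k\<le>m. a k * z ^ (m - k))"
      unfolding a_def by (rule Suc)
    have B: "poly (U_poly s (Suc m)) (1 + z) = (-1) ^ Suc m * (\<Sum>k\<le>Suc m. b k * z ^ (Suc m - k))"
      unfolding b_def by (rule IH)
    have C: "poly (U_poly s m) (1 + z) = (-1) ^ m * (\<Sum>k\<le>m. c k * z ^ (m - k))"
      unfolding c_def by (rule IH)
    have z: "z * (\<Sum>k\<le>m. a k * z ^ (m - k)) = (\<Sum>k\<le>m. a k * z ^ (Suc m - k))"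
      unfolding sum_distrib_left by (rule sum.cong) (auto simp: Suc_diff_le)
    have "poly (U_poly (Suc s) (Suc m)) (1 + z)
       = (1 - (1 + z)) * poly (U_poly (Suc s) m) (1 + z) + poly (U_poly s (Suc m)) (1 + z)
          - poly (U_poly s m) (1 + z)"
      unfolding U_poly_rec by (simp add: algebra_simps)
    also have "\<dots> = (-1) ^ Suc m * (z * (\<Sum>k\<le>m. a k * z ^ (m - k)) + (\<Sum>k\<le>Suc m. b k * z ^ (Suc m - k))
       + (\<Sum>k\<le>m. c k * z ^ (m - k)))"
      unfolding A B C by (simp add: algebra_simps del: sum.atMost_Suc)
    also note z
    also have "(\<Sum>k\<le>m. c k * z ^ (m - k)) = (\<Sum>k\<le>Suc m. (if k = 0 then 0 else c (k - 1)) * z ^ (Suc m - k))"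
      by (subst sum.atMost_Suc_shift) simp
    \<comment> \<open>The added term is zero: \<open>a (Suc m)\<close> contains binomial(s, s +
      1).\<close>
    also have "(\<Sum>k\<le>m. a k * z ^ (Suc m - k)) = (\<Sum>k\<le>Suc m. a k * z ^ (Suc m - k))"
      by (simp add: a_def)
    also have "(\<Sum>k\<le>Suc m. a k * z ^ (Suc m - k)) + (\<Sum>k\<le>Suc m. b k * z ^ (Suc m - k)) +
        (\<Sum>k\<le>Suc m. (if k = 0 then 0 else c (k - 1)) * z ^ (Suc m - k)) =
        (\<Sum>k\<le>Suc m. (a k + b k + (if k = 0 then 0 else c (k - 1))) * z ^ (Suc m - k))"
      by (simp add: sum.distrib algebra_simps del: sum.atMost_Suc)
    \<comment> \<open>Pascal's rule for both factors of \<open>d k\<close>; the case k = 0 has no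
      \<open>c\<close> term.\<close>
    also have "\<dots> = (\<Sum>k\<le>Suc m. d k * z ^ (Suc m - k))"
    proof (rule sum.cong)
      fix k assume k: "k \<in> {..Suc m}"
      show "(a k + b k + (if k = 0 then 0 else c (k - 1))) * z ^ (Suc m - k) = d k * z ^ (Suc m - k)"
      proof (cases k)
        case 0
        then show ?thesis by (simp add: a_def b_def d_def)
      next
        case (Suc j)
        with k have "s + Suc m - k = s + m - j" "Suc s + m - k = s + m - j" "Suc s + Suc m - k = Suc (s + m - j)"
          by auto
        then show ?thesis using Suc by (simp add: a_def b_def c_def d_def algebra_simps)
      qed
    qed simp
    finally show ?case by (simp only: d_def)
  qed
qed

text \<open>Euler's transformation for F(-m, s + 1; 1; t). In powers of z = t - 1, the coefficients
  in \<open>U_poly_shift\<close> are (s + m - k)! / (k! (s - k)! (m - k)!), symmetric in s and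
  m.\<close>

lemma U_poly_sym:
  "(1 - t) ^ s * poly (U_poly s m) t = (1 - t) ^ m * poly (U_poly m s) t"
proof -
  define z where "z = t - 1"
  have t: "t = 1 + z" by (simp add: z_def)
  have main: "(-1) ^ s * z ^ s * poly (U_poly s m) (1 + z) =
     (-1) ^ (s + m) * (\<Sum>k\<in>{..min s m}. fact (s + m - k) / (fact k * fact (s - k) * fact (m - k)) * z ^ (s + m - k))"
    for s m
  proof -
    have "(-1) ^ s * z ^ s * poly (U_poly s m) (1 + z) =
      (-1) ^ (s + m) * (\<Sum>k\<le>m. real (s choose k) * real (s + m - k choose s) * z ^ (s + m - k))"
    proof -
      have "z ^ s * (\<Sum>k\<le>m. real (s choose k) * real (s + m - k choose s) * z ^ (m - k)) =
        (\<Sum>k\<le>m. real (s choose k) * real (s + m - k choose s) * z ^ (s + m - k))"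
        unfolding sum_distrib_left by (rule sum.cong) (simp_all flip: power_add)
      then show ?thesis
        by (simp add: U_poly_shift power_add mult.assoc mult.left_commute)
    qed
    also have "(\<Sum>k\<le>m. real (s choose k) * real (s + m - k choose s) * z ^ (s + m - k)) =
      (\<Sum>k\<in>{..min s m}. real (s choose k) * real (s + m - k choose s) * z ^ (s + m - k))"
      by (rule sum.mono_neutral_right) (auto simp: binomial_eq_0)
    also have "\<dots> = (\<Sum>k\<in>{..min s m}. fact (s + m - k) / (fact k * fact (s - k) * fact (m - k)) * z ^ (s + m - k))"
      by (rule sum.cong) (auto simp: binomial_fact)
    finally show ?thesis .
  qed
  have "(-1) ^ s * z ^ s * poly (U_poly s m) (1 + z) = (-1) ^ m * z ^ m * poly (U_poly m s) (1 + z)"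
    unfolding main by (simp add: min.commute add.commute mult.commute mult.left_commute)
  then show ?thesis
    unfolding t by (simp add: power_minus')
qed

text \<open>Inherited from \<open>U_poly_sym\<close> through \<open>U_minus_U_Suc\<close>. With n =
  s + m + 2 it pairs the index s + 1 with n - (s + 1): for 0 < t < 1 both polynomials have the same
  sign, so only half of the indices need analysis.\<close>

lemma S_poly_sym:
  assumes "t \<noteq> 0"
  shows "(1 - t) ^ Suc s * poly (S_poly (Suc s) m) t = (1 - t) ^ Suc m * poly (S_poly (Suc m) s) t"
proof -
  have *: "real (s + m + 2) * t * ((1 - t) ^ Suc s * poly (S_poly (Suc s) m) t) =
      (1 - t) * ((1 - t) ^ s * poly (U_poly s m) t) - (1 - t) ^ Suc s * poly (U_poly (Suc s) (Suc m)) t"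
    for s m
  proof -
    have "poly (U_poly s m) t - poly (U_poly (Suc s) (Suc m)) t = real (s + m + 2) * (t * poly (S_poly (Suc s) m) t)"
      by (simp flip: poly_diff add: U_minus_U_Suc)
    then have "(1 - t) ^ Suc s * (poly (U_poly s m) t - poly (U_poly (Suc s) (Suc m)) t) =
        (1 - t) ^ Suc s * (real (s + m + 2) * (t * poly (S_poly (Suc s) m) t))"
      by simp
    then show ?thesis
      by (simp only: right_diff_distrib power_Suc mult_ac)
  qed
  have "real (s + m + 2) * t * ((1 - t) ^ Suc s * poly (S_poly (Suc s) m) t) =
      real (m + s + 2) * t * ((1 - t) ^ Suc m * poly (S_poly (Suc m) s) t)"
    unfolding * using U_poly_sym[of t s m] U_poly_sym[of t "Suc s" "Suc m"] by simp
  then show ?thesis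
    using assms by (simp add: add.commute)
qed

section \<open>Identification with the hypergeometric polynomial\<close>

lemma pochhammer_neg_of_nat:
  assumes "k \<le> a"
  shows "pochhammer (- real a) k = (-1) ^ k * fact a / fact (a - k)"
  using gbinomial_pochhammer[of "real a" k] assms
  by (simp add: binomial_gbinomial[symmetric] binomial_fact field_simps)

text \<open>Expand both terms on the left of \<open>U_minus_U_Suc\<close> at t = 1 and compare
  coefficients. The hypotheses allow s = m (even n) and s = m + 1 (odd n); the factor 1 + z = t
  produces the zero -1 that the theorem excludes.\<close>

lemma hypergeo_poly_eq_S_poly:
  assumes "m \<le> s" "s \<le> Suc m"
  defines "n \<equiv> Suc s + Suc m"
  shows "real (n choose Suc m) * poly (hypergeo_poly n) z =
      (-1) ^ m * real n * (1 + z) * poly (S_poly (Suc s) m) (1 + z)"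
proof -
  have nu: "n div 2 = Suc m"
    using assms by (simp add: n_def)
  define h where "h k = pochhammer (- real (Suc m)) k * pochhammer (real (Suc m) - real n) k /
    (pochhammer (1 - real n) k * fact k) * (-1) ^ k" for k
  define a where "a k = real (s choose k) * real (s + m - k choose s)" for k
  define b where "b k = real (Suc s choose k) * real (Suc s + Suc m - k choose Suc s)" for k
  \<comment> \<open>\<open>a\<close> and \<open>b\<close> are the coefficients of the two
    expansions; the shift aligns them at the same power of z.\<close>
  define a' where "a' k = (if k = 0 then 0 else a (k - 1))" for k
  have h: "h k = fact (Suc m) * fact (Suc s) * fact (Suc (s + m) - k) /
      (fact (Suc m - k) * fact (Suc s - k) * fact (Suc (s + m)) * fact k)" if "k \<le> Suc m" for k
  proof -
    have e: "real (Suc m) - real n = - real (Suc s)" "1 - real n = - real (Suc (s + m))"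
      by (simp_all add: n_def)
    have k: "k \<le> Suc s" "k \<le> Suc (s + m)"
      using that assms by auto
    have "((-1) ^ k * (-1) ^ k :: real) = 1"
      by (simp flip: power_mult_distrib)
    then show ?thesis
      unfolding h_def e pochhammer_neg_of_nat[OF that] pochhammer_neg_of_nat[OF k(1)] pochhammer_neg_of_nat[OF k(2)]
      by (simp add: divide_simps mult_ac)
  qed
  have ab: "a' k + b k = real (n choose Suc m) * h k" if k: "k \<le> Suc m" for k
  proof -
    have n1: "fact n = real n * fact (Suc (s + m))"
      by (simp add: n_def)
    have c: "real (n choose Suc m) = fact n / (fact (Suc m) * fact (Suc s))"
      by (subst binomial_fact) (simp_all add: n_def del: fact_Suc)
    have r: "real (n choose Suc m) * h k = real n * fact (Suc (s + m) - k) /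
        (fact (Suc m - k) * fact (Suc s - k) * fact k)"
      unfolding c h[OF k] n1 by (simp del: fact_Suc of_nat_Suc add: field_simps)
    show ?thesis
    proof (cases k)
      case 0
      have "fact (Suc s + Suc m) = real n * fact (Suc (s + m))"
        by (simp add: n_def)
      then show ?thesis
        unfolding r using 0 by (simp add: a'_def b_def binomial_fact del: fact_Suc binomial_Suc_Suc)
    next
      case (Suc j)
      with k assms have j: "j \<le> m" "j \<le> s" by auto
      define P where "P = fact (s + m - j) / (fact (s - j) * fact (m - j) :: real)"
      have "a' k = P / fact j"
        using j by (simp add: Suc a'_def a_def P_def binomial_fact)
      moreover have "b k = real (Suc (s + m - j)) * P / fact k"
        using j by (simp add: Suc b_def P_def binomial_fact Suc_diff_le del: of_nat_Suc binomial_Suc_Suc)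
      moreover have "real (n choose Suc m) * h k = real n * P / fact k"
        unfolding r P_def using Suc by (simp add: mult_ac del: fact_Suc)
      \<comment> \<open>The two summands are the numerators of \<open>a' k\<close> and
        \<open>b k\<close> over the common fraction P / k!.\<close>
      moreover have "real n = real (Suc j) + real (Suc (s + m - j))"
        using j by (simp add: n_def)
      moreover have "P / fact j = real (Suc j) * P / fact k"
        using Suc by (simp del: of_nat_Suc)
      ultimately show ?thesis
        by (simp add: algebra_simps add_divide_distrib)
    qed
  qed
  have "real (n choose Suc m) * poly (hypergeo_poly n) z =
      (\<Sum>k\<le>Suc m. real (n choose Suc m) * h k * z ^ (Suc m - k))"
    unfolding hypergeo_poly_def Let_def nu poly_sum poly_monom h_def[symmetric] sum_distrib_left mult.assoc
    by (rule refl)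
  also have "\<dots> = (\<Sum>k\<le>Suc m. (a' k + b k) * z ^ (Suc m - k))"
    by (rule sum.cong) (simp_all add: ab del: sum.atMost_Suc)
  also have "\<dots> = (\<Sum>k\<le>Suc m. a' k * z ^ (Suc m - k)) + (\<Sum>k\<le>Suc m. b k * z ^ (Suc m - k))"
    by (simp add: distrib_right sum.distrib del: sum.atMost_Suc)
  also have "(\<Sum>k\<le>Suc m. a' k * z ^ (Suc m - k)) = (\<Sum>k\<le>m. a k * z ^ (m - k))"
    by (subst sum.atMost_Suc_shift) (simp add: a'_def)
  also have "\<dots> + (\<Sum>k\<le>Suc m. b k * z ^ (Suc m - k)) =
      (-1) ^ m * (poly (U_poly s m) (1 + z) - poly (U_poly (Suc s) (Suc m)) (1 + z))"
  proof -
    have "((-1) ^ m * (-1) ^ m :: real) = 1"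
      by (simp flip: power_mult_distrib)
    then show ?thesis
      unfolding U_poly_shift a_def b_def
      by (simp add: algebra_simps del: sum.atMost_Suc binomial_Suc_Suc)
  qed
  also have "poly (U_poly s m) (1 + z) - poly (U_poly (Suc s) (Suc m)) (1 + z) =
      real n * ((1 + z) * poly (S_poly (Suc s) m) (1 + z))"
    by (simp flip: poly_diff add: U_minus_U_Suc n_def)
  finally show ?thesis
    by (simp add: mult_ac)
qed

section \<open>Diagonalising the matrix\<close>

text \<open>Summing the recurrence along the antidiagonals s + m = n - 1 gives a linear recurrence
  with characteristic polynomial y^2 - (c + x) y + x, whose roots will be a and b. The second
  identity groups the terms so that \<open>U_minus_U_Suc\<close> applies to each.\<close>

lemma two_variable_recurrence:
  fixes u :: "nat \<Rightarrow> nat \<Rightarrow> 'a::comm_ring_1" and x :: 'a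
  assumes rec: "\<And>s m. u (Suc s) (Suc m) = c * u (Suc s) m + u s (Suc m) - u s m"
    and left: "\<And>m. u 0 (Suc m) = c * u 0 m" and right: "\<And>s. u s 0 = 1"
  defines "V \<equiv> \<lambda>n. \<Sum>s<n. x ^ s * u s (n - 1 - s)"
  shows "V (Suc (Suc n)) = (c + x) * V (Suc n) - x * V n"
    and "V (Suc (Suc n)) - x * V n =
      u 0 (Suc n) + (\<Sum>s<n. x ^ Suc s * (u (Suc s) (n - s) - u s (n - Suc s))) + x ^ Suc n"
proof -
  have 1: "V (Suc (Suc n)) = u 0 (Suc n) + (\<Sum>s<n. x ^ Suc s * u (Suc s) (n - s)) + x ^ Suc n"
    unfolding V_def by (subst sum.lessThan_Suc_shift) (simp add: right)
  have 2: "V (Suc n) = u 0 n + (\<Sum>s<n. x ^ Suc s * u (Suc s) (n - Suc s))"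
    unfolding V_def by (subst sum.lessThan_Suc_shift) simp
  have 3: "V (Suc n) = (\<Sum>s<n. x ^ s * u s (n - s)) + x ^ n"
    unfolding V_def by (simp add: right)
  have 4: "V n = (\<Sum>s<n. x ^ s * u s (n - Suc s))"
    unfolding V_def by simp
  have 5: "(\<Sum>s<n. x ^ s * u s (n - s)) = V (Suc n) - x ^ n"
    unfolding 3 by simp
  have 6: "(\<Sum>s<n. x ^ Suc s * u (Suc s) (n - Suc s)) = V (Suc n) - u 0 n"
    unfolding 2 by simp
  show "V (Suc (Suc n)) - x * V n =
      u 0 (Suc n) + (\<Sum>s<n. x ^ Suc s * (u (Suc s) (n - s) - u s (n - Suc s))) + x ^ Suc n"
    unfolding 1 4 by (simp add: sum_distrib_left algebra_simps sum_subtractf)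
  have "(\<Sum>s<n. x ^ Suc s * u (Suc s) (n - s)) =
      (\<Sum>s<n. c * (x ^ Suc s * u (Suc s) (n - Suc s)) + x * (x ^ s * u s (n - s)) - x * (x ^ s * u s (n - Suc s)))"
  proof (rule sum.cong)
    fix s assume "s \<in> {..<n}"
    then have "n - s = Suc (n - Suc s)" by auto
    then show "x ^ Suc s * u (Suc s) (n - s) =
        c * (x ^ Suc s * u (Suc s) (n - Suc s)) + x * (x ^ s * u s (n - s)) - x * (x ^ s * u s (n - Suc s))"
      by (simp add: rec algebra_simps)
  qed simp
  also have "\<dots> = c * (V (Suc n) - u 0 n) + x * (V (Suc n) - x ^ n) - x * V n"
    by (simp only: sum.distrib sum_subtractf sum_distrib_left[symmetric] 5 6 4)
  finally show "V (Suc (Suc n)) = (c + x) * V (Suc n) - x * V n"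
    unfolding 1 by (simp add: left algebra_simps)
qed

text \<open>Since \<open>(1 - a) (1 - b) = t\<close>, this expands \<open>(1 - a^N) (1 - b^N)\<close> in powers of
  \<open>t\<close> and \<open>x = a b\<close>; the power sums \<open>a^N + b^N\<close> come from a Lucas-type recurrence.\<close>

lemma power_sum_S_poly:
  fixes a b x :: complex
  assumes ab: "a * b = x" "a + b = 1 + x - of_real t"
  shows "(a ^ Suc n - 1) * (b ^ Suc n - 1) =
    (\<Sum>s<Suc n. of_real (real (Suc n) * t * poly (S_poly s (n - s)) t) * x ^ s)"
proof -
  define u :: "nat \<Rightarrow> nat \<Rightarrow> complex" where "u s m = of_real (poly (U_poly s m) t)" for s m
  define V where "V n = (\<Sum>s<n. x ^ s * u s (n - 1 - s))" for n
  define c :: complex where "c = 1 - of_real t"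
  have rec: "u (Suc s) (Suc m) = c * u (Suc s) m + u s (Suc m) - u s m" for s m
    unfolding u_def U_poly_rec by (simp add: c_def algebra_simps)
  have left: "u 0 (Suc m) = c * u 0 m" for m
    by (simp add: u_def U_poly_0_left c_def algebra_simps)
  have right: "u s 0 = 1" for s
    by (simp add: u_def)
  have ab': "a + b = c + x"
    using ab by (simp add: c_def)
  note V = two_variable_recurrence[of u, OF rec left right, of x, folded V_def]
  have V0: "V 0 = 0" and V1: "V (Suc 0) = 1"
    by (simp_all add: V_def right)
  \<comment> \<open>\<open>V\<close> is the Lucas sequence (a^n - b^n) / (a - b); induction avoids
    this quotient and so includes a = b.\<close>
  have ab_power: "a ^ Suc n + b ^ Suc n = V (Suc (Suc n)) - x * V n" for n
  proof (induction n rule: nat_less_induct)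
    case (1 n)
    consider "n = 0" | "n = 1" | k where "n = Suc (Suc k)"
      by (metis One_nat_def not0_implies_Suc)
    then show ?case
    proof cases
      case 1
      then show ?thesis by (simp add: V V0 V1 ab')
    next
      case 2
      have "a\<^sup>2 + b\<^sup>2 = (a + b)\<^sup>2 - 2 * (a * b)"
        by (simp add: power2_eq_square algebra_simps)
      then show ?thesis
        unfolding ab(1) ab' using 2 by (simp add: V V0 V1 power2_eq_square algebra_simps)
    next
      case 3
      have "a ^ Suc n + b ^ Suc n = (a + b) * (a ^ Suc (Suc k) + b ^ Suc (Suc k)) - a * b * (a ^ Suc k + b ^ Suc k)"
        unfolding 3 by (simp add: algebra_simps)
      also have "\<dots> = (c + x) * (V (Suc (Suc (Suc k))) - x * V (Suc k)) - x * (V (Suc (Suc k)) - x * V k)"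
        unfolding ab(1) ab' using 1 3 by (metis less_Suc_eq)
      also have "\<dots> = V (Suc (Suc n)) - x * V n"
        unfolding 3 V(1)[of "Suc (Suc k)"] V(1)[of k] V(1)[of "Suc k"] by (simp add: algebra_simps)
      finally show ?thesis .
    qed
  qed
  have "(a ^ Suc n - 1) * (b ^ Suc n - 1) = 1 + x ^ Suc n - (a ^ Suc n + b ^ Suc n)"
    by (simp add: algebra_simps power_mult_distrib flip: ab(1))
  also have "\<dots> = (1 - u 0 (Suc n)) + (\<Sum>s<n. x ^ Suc s * (u s (n - Suc s) - u (Suc s) (n - s)))"
    unfolding ab_power V(2) by (simp add: algebra_simps sum_subtractf)
  also have "(\<Sum>s<n. x ^ Suc s * (u s (n - Suc s) - u (Suc s) (n - s))) =
      (\<Sum>s<n. of_real (real (Suc n) * t * poly (S_poly (Suc s) (n - Suc s)) t) * x ^ Suc s)"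
  proof (rule sum.cong)
    fix s assume "s \<in> {..<n}"
    then obtain m where n: "n = Suc (s + m)"
      using less_iff_Suc_add by auto
    have "poly (U_poly s m) t - poly (U_poly (Suc s) (Suc m)) t = real (Suc n) * t * poly (S_poly (Suc s) m) t"
      by (simp flip: poly_diff add: U_minus_U_Suc n)
    then show "x ^ Suc s * (u s (n - Suc s) - u (Suc s) (n - s)) =
        of_real (real (Suc n) * t * poly (S_poly (Suc s) (n - Suc s)) t) * x ^ Suc s"
      unfolding u_def by (simp add: n Suc_diff_le mult.commute flip: of_real_diff)
  qed simp
  also have "1 - u 0 (Suc n) = of_real (real (Suc n) * t * poly (S_poly 0 n) t)"
  proof -
    have "1 - poly (U_poly 0 (Suc n)) t = poly (1 - U_poly 0 (Suc n)) t"
      by simp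
    also have "\<dots> = real (Suc n) * t * poly (S_poly 0 n) t"
      unfolding one_minus_U_poly by simp
    finally show ?thesis
      unfolding u_def by (metis of_real_1 of_real_diff)
  qed
  finally show ?thesis
    by (subst sum.lessThan_Suc_shift) simp
qed

section \<open>Roots of unity and the circulant structure\<close>

lemma root_unity_power: "root_unity n ^ k = exp (2 * of_real pi * \<i> * of_nat k / of_nat n)"
  by (simp add: root_unity_def exp_of_nat_mult[symmetric] mult_ac)

lemma root_unity_power_eq_iff:
  assumes "j < n" "k < n"
  shows "root_unity n ^ j = root_unity n ^ k \<longleftrightarrow> j = k"
  using assms complex_root_unity_eq[of n j k] by (simp add: root_unity_power)

lemma root_unity_power_n: "n > 0 \<Longrightarrow> root_unity n ^ n = 1"
  by (simp add: root_unity_power)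

lemma norm_root_unity [simp]: "norm (root_unity n) = 1"
  by (simp add: root_unity_def)

lemma root_unity_mult_cnj: "root_unity n ^ k * cnj (root_unity n ^ k) = 1"
  by (simp add: complex_norm_square[symmetric] norm_power del: complex_cnj_power)

text \<open>Both sides are monic of degree n in c and vanish at the same n distinct points.\<close>

lemma prod_diff_root_unity:
  assumes "n > 0"
  shows "(\<Prod>k=1..n. c - root_unity n ^ k) = c ^ n - 1"
proof -
  define w where "w = root_unity n"
  have wn: "w ^ n = 1"
    using assms by (simp add: w_def root_unity_power_n)
  have inj: "inj_on (\<lambda>k. w ^ k) {1..n}"
  proof (rule inj_onI)
    fix j k assume jk: "j \<in> {1..n}" "k \<in> {1..n}" "w ^ j = w ^ k"
    \<comment> \<open>Exponents run over 1..n here, but \<open>root_unity_power_eq_iff\<close> needs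
      them below n; one factor w is cancelled.\<close>
    then have "w ^ (j - 1) = w ^ (k - 1)"
      by (cases j; cases k) (auto simp: w_def root_unity_def)
    then have "j - 1 = k - 1"
      using jk by (auto simp: w_def root_unity_power_eq_iff)
    then show "j = k" using jk by auto
  qed
  define p where "p = (\<Prod>k=1..n. [:- (w ^ k), 1:])"
  have deg: "degree p = n"
    unfolding p_def by (subst degree_prod_eq_sum_degree) auto
  have "p = monom 1 n - 1"
  proof (rule poly_eqI_degree_lead_coeff[where n = n and A = "(\<lambda>k. w ^ k) ` {1..n}"])
    have "lead_coeff p = 1"
      by (simp add: p_def lead_coeff_prod)
    then show "coeff p n = coeff (monom 1 n - 1) n"
      using deg assms by simp
    show "card ((\<lambda>k. w ^ k) ` {1..n}) \<ge> n"
      using card_image[OF inj] by simp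
    show "degree (monom 1 n - 1 :: complex poly) \<le> n"
      by (rule degree_diff_le) (simp_all add: degree_monom_le)
    fix z assume "z \<in> (\<lambda>k. w ^ k) ` {1..n}"
    then obtain k where k: "k \<in> {1..n}" "z = w ^ k" by auto
    have "poly p z = 0"
      unfolding p_def poly_prod by (rule prod_zero) (use k in auto)
    moreover have "z ^ n = 1"
      using wn k by (metis power_commutes power_mult power_one mult.commute)
    ultimately show "poly p z = poly (monom 1 n - 1) z"
      by (simp add: poly_monom)
  qed (use deg in simp)
  then have "poly p c = c ^ n - 1"
    by (simp add: poly_monom)
  then show ?thesis
    by (simp add: p_def poly_prod w_def)
qed

lemma disk_matrix_entry:
  assumes "i < Suc n" "j < Suc n"
  shows "disk_matrix (Suc n) r $$ (i, j) =
    (\<Sum>s<Suc n. of_real (real (Suc n) * r\<^sup>2 * poly (S_poly s (n - s)) (r\<^sup>2)) *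
      (root_unity (Suc n) ^ i * cnj (root_unity (Suc n) ^ j)) ^ s)"
proof -
  define w where "w = root_unity (Suc n)"
  define x where "x = w ^ i * cnj (w ^ j)"
  define v where "v = w ^ Suc j"
  have unit: "w ^ k * cnj (w ^ k) = 1" for k
    by (simp add: w_def root_unity_mult_cnj del: complex_cnj_power)
  have wn: "w ^ Suc n = 1"
    unfolding w_def by (rule root_unity_power_n) simp
  \<comment> \<open>The shifts by \<open>Suc\<close> in both centers cancel because w has modulus
    1.\<close>
  have x: "x = w ^ Suc i * cnj v"
    using unit[of 1] by (simp add: x_def v_def algebra_simps)
  have v: "v * cnj v = 1"
    unfolding v_def by (rule unit)
  have vn: "v ^ Suc n = 1"
    using wn by (metis v_def power_commutes power_mult power_one mult.commute)
  have cvn: "cnj v ^ Suc n = 1"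
    using vn by (metis complex_cnj_one complex_cnj_power)
  \<comment> \<open>The roots of y^2 - q y + x, by the quadratic formula over the complex
    numbers.\<close>
  obtain a b where ab: "a * b = x" "a + b = 1 + x - of_real (r\<^sup>2)"
  proof -
    define q where "q = 1 + x - of_real (r\<^sup>2)"
    define d where "d = csqrt (q\<^sup>2 - 4 * x)"
    have "d\<^sup>2 = q\<^sup>2 - 4 * x"
      by (simp add: d_def)
    then have "(q + d) / 2 * ((q - d) / 2) = x"
      by (simp add: algebra_simps power2_eq_square)
    moreover have "(q + d) / 2 + (q - d) / 2 = q"
      by (simp add: field_simps)
    ultimately show ?thesis
      using that unfolding q_def by blast
  qed
  \<comment> \<open>On the unit circle conjugates are inverses. Each bracket, including the
    denominator, has the form c - w^k, so \<open>prod_diff_root_unity\<close> evaluates all three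
    products; the denominator is the case c = 0.\<close>
  have factor: "(w ^ Suc i - w ^ k) * cnj (v - w ^ k) - of_real (r\<^sup>2) =
      cnj v * (a * v - w ^ k) * (cnj v * (b * v - w ^ k)) / (cnj v * (0 - w ^ k))" for k
  proof -
    define y where "y = w ^ k"
    have y: "y * cnj y = 1" unfolding y_def by (rule unit)
    have nz: "y \<noteq> 0" "cnj v \<noteq> 0" using y v by auto
    have cy: "cnj y = 1 / y" and cv: "v = 1 / cnj v"
      using y v nz by (auto simp: field_simps)
    have "(w ^ Suc i - y) * cnj (v - y) - of_real (r\<^sup>2) =
        w ^ Suc i * cnj v - w ^ Suc i * cnj y - y * cnj v + y * cnj y - of_real (r\<^sup>2)"
      by (simp add: algebra_simps)
    also have "w ^ Suc i * cnj y = x * (v * cnj y)"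
      using v unfolding x by (simp add: mult_ac)
    also have "w ^ Suc i * cnj v - x * (v * cnj y) - y * cnj v + y * cnj y - of_real (r\<^sup>2) =
        (a + b) - a * b * (v * cnj y) - y * cnj v"
      unfolding y ab by (simp add: x)
    also have "\<dots> = cnj v * (a * v - y) * (cnj v * (b * v - y)) / (cnj v * (0 - y))"
      using nz unfolding cy by (subst (1 2 3) cv) (simp add: field_simps)
    finally show ?thesis by (simp add: y_def)
  qed
  have "(\<Prod>k=1..Suc n. (w ^ Suc i - w ^ k) * cnj (v - w ^ k) - of_real (r\<^sup>2)) =
     cnj v ^ Suc n * (\<Prod>k=1..Suc n. a * v - w ^ k) * (cnj v ^ Suc n * (\<Prod>k=1..Suc n. b * v - w ^ k)) /
      (cnj v ^ Suc n * (\<Prod>k=1..Suc n. 0 - w ^ k))"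
    unfolding factor prod_dividef prod.distrib prod_constant by simp
  also have "\<dots> = (a ^ Suc n - 1) * (b ^ Suc n - 1) / (-1)"
    unfolding w_def prod_diff_root_unity[OF zero_less_Suc] power_mult_distrib vn cvn by simp
  finally have "- (\<Prod>k=1..Suc n. (w ^ Suc i - w ^ k) * cnj (v - w ^ k) - of_real (r\<^sup>2)) =
      (a ^ Suc n - 1) * (b ^ Suc n - 1)"
    by simp
  also note power_sum_S_poly[OF ab, of n]
  finally show ?thesis
    using assms unfolding disk_matrix_def Let_def
    by (simp add: w_def v_def x_def del: prod.cl_ivl_Suc sum.lessThan_Suc)
qed

lemma root_unity_orthogonal:
  assumes "s < n" "u < n"
  shows "(\<Sum>i<n. (root_unity n ^ i) ^ s * cnj ((root_unity n ^ i) ^ u)) = (if s = u then of_nat n else 0)"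
proof -
  define w where "w = root_unity n"
  define q where "q = w ^ s * cnj (w ^ u)"
  have n: "n > 0" using assms by simp
  have q: "q = 1 \<longleftrightarrow> s = u"
  proof
    assume "q = 1"
    then have "w ^ s * (w ^ u * cnj (w ^ u)) = w ^ u"
      unfolding q_def by (metis mult.left_commute mult.right_neutral)
    then show "s = u"
      using assms by (simp add: w_def root_unity_mult_cnj root_unity_power_eq_iff del: complex_cnj_power)
  qed (simp add: q_def w_def root_unity_mult_cnj del: complex_cnj_power)
  have "w ^ n = 1"
    using n by (simp add: w_def root_unity_power_n)
  then have qn: "q ^ n = 1"
    unfolding q_def power_mult_distrib complex_cnj_power[symmetric]
    by (metis complex_cnj_one mult.commute mult_1 power_mult power_one)
  have "(\<Sum>i<n. (w ^ i) ^ s * cnj ((w ^ i) ^ u)) = (\<Sum>i<n. q ^ i)"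
    by (rule sum.cong) (simp_all add: q_def power_mult_distrib flip: power_mult, simp add: mult.commute)
  also have "\<dots> = (if s = u then of_nat n else 0)"
    using q qn by (auto simp: geometric_sum)
  finally show ?thesis by (simp add: w_def)
qed

text \<open>The discrete Fourier transform \<open>F\<close> turns the quadratic form into the sum of
  e s |F v s|^2. Fourier vectors as test vectors isolate each \<open>e u\<close>; conversely, if all
  \<open>e s\<close> are positive, a vanishing form forces \<open>F v\<close> to vanish and hence v
  = 0.\<close>

lemma pos_def_mat_circulant:
  assumes A: "A \<in> carrier_mat n n"
    and entry: "\<And>i j. i < n \<Longrightarrow> j < n \<Longrightarrow>
      A $$ (i, j) = (\<Sum>s<n. of_real (e s) * (root_unity n ^ i * cnj (root_unity n ^ j)) ^ s)"
  shows "pos_def_mat A \<longleftrightarrow> (\<forall>s<n. e s > 0)"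
proof -
  define w where "w = root_unity n"
  define F where "F v s = (\<Sum>i<n. (w ^ i) ^ s * cnj (v $ i))" for v :: "complex vec" and s
  have quad: "(A *\<^sub>v v) \<bullet>c v = of_real (\<Sum>s<n. e s * (cmod (F v s))\<^sup>2)" if v: "v \<in> carrier_vec n" for v
  proof -
    have "(A *\<^sub>v v) \<bullet>c v = (\<Sum>i<n. (\<Sum>j<n. A $$ (i, j) * v $ j) * cnj (v $ i))"
      using A v by (auto simp: scalar_prod_def atLeast0LessThan mult_mat_vec_def intro!: sum.cong)
    also have "\<dots> = (\<Sum>i<n. \<Sum>j<n. \<Sum>s<n. of_real (e s) * (((w ^ i) ^ s * cnj (v $ i)) * (cnj ((w ^ j) ^ s) * v $ j)))"
      by (intro sum.cong)
        (simp_all add: entry w_def sum_distrib_left sum_distrib_right power_mult_distrib mult_ac)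
    also have "\<dots> = (\<Sum>i<n. \<Sum>s<n. \<Sum>j<n. of_real (e s) * (((w ^ i) ^ s * cnj (v $ i)) * (cnj ((w ^ j) ^ s) * v $ j)))"
      by (intro sum.cong refl sum.swap)
    also have "\<dots> = (\<Sum>s<n. \<Sum>i<n. \<Sum>j<n. of_real (e s) * (((w ^ i) ^ s * cnj (v $ i)) * (cnj ((w ^ j) ^ s) * v $ j)))"
      by (rule sum.swap)
    also have "\<dots> = (\<Sum>s<n. of_real (e s) * (F v s * cnj (F v s)))"
      unfolding F_def cnj_sum sum_product by (simp add: sum_distrib_left)
    finally show ?thesis
      unfolding complex_norm_square[symmetric] by simp
  qed
  have adj: "mat_adjoint A = A"
  proof (rule eq_matI)
    fix i j assume ij: "i < dim_row A" "j < dim_col A"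
    then have "mat_adjoint A $$ (i, j) = cnj (A $$ (j, i))"
      using A by (simp add: mat_adjoint_def mat_of_rows_index)
    also have "\<dots> = A $$ (i, j)"
      using ij A by (simp add: entry mult.commute)
    finally show "mat_adjoint A $$ (i, j) = A $$ (i, j)" .
  qed (use A in \<open>auto simp: mat_adjoint_def\<close>)
  have dims: "dim_row A = n" "dim_col A = n"
    using A by auto
  show ?thesis
  proof
    assume pd: "pos_def_mat A"
    show "\<forall>s<n. e s > 0"
    proof (intro allI impI)
      fix u assume u: "u < n"
      define v where "v = vec n (\<lambda>i. (w ^ i) ^ u)"
      have v: "v \<in> carrier_vec n" by (simp add: v_def)
      have F: "F v s = (if s = u then of_nat n else 0)" if "s < n" for s
        using root_unity_orthogonal[OF that u] by (simp add: F_def v_def w_def)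
      have "v $ 0 \<noteq> 0\<^sub>v n $ 0"
        using u by (simp add: v_def)
      then have "v \<noteq> 0\<^sub>v n" by auto
      then have "0 < (\<Sum>s<n. e s * (cmod (F v s))\<^sup>2)"
        using pd v unfolding pos_def_mat_def dims quad[OF v] by (metis Re_complex_of_real quad)
      also have "\<dots> = (\<Sum>s<n. if s = u then e u * (real n)\<^sup>2 else 0)"
        by (rule sum.cong) (auto simp: F)
      also have "\<dots> = e u * (real n)\<^sup>2"
        using u by simp
      finally show "e u > 0"
        using zero_less_mult_pos2 u by fastforce
    qed
  next
    assume e: "\<forall>s<n. e s > 0"
    have "0 < (\<Sum>s<n. e s * (cmod (F v s))\<^sup>2)" if v: "v \<in> carrier_vec n" "v \<noteq> 0\<^sub>v n" for v
    proof (rule ccontr)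
      assume "\<not> ?thesis"
      moreover have nonneg: "e s * (cmod (F v s))\<^sup>2 \<ge> 0" if "s < n" for s
        using e that by (simp add: less_imp_le)
      ultimately have "(\<Sum>s<n. e s * (cmod (F v s))\<^sup>2) = 0"
        by (meson lessThan_iff linorder_not_le order_antisym sum_nonneg)
      then have "\<forall>s\<in>{..<n}. e s * (cmod (F v s))\<^sup>2 = 0"
        using nonneg by (subst (asm) sum_nonneg_eq_0_iff) auto
      then have F0: "F v s = 0" if "s < n" for s
        using e that by (metis lessThan_iff less_irrefl mult_eq_0_iff norm_eq_zero zero_eq_power2)
      have "v $ j = 0" if j: "j < n" for j
      proof -
        \<comment> \<open>Fourier inversion: orthogonality with the roles of exponent and summation
          index exchanged.\<close>
        have "0 = (\<Sum>s<n. F v s * cnj ((w ^ s) ^ j))"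
          by (simp add: F0)
        also have "\<dots> = (\<Sum>s<n. \<Sum>i<n. cnj (v $ i) * ((w ^ s) ^ i * cnj ((w ^ s) ^ j)))"
          unfolding F_def sum_distrib_right
          by (intro sum.cong refl) (simp add: power_mult[symmetric] mult_ac)
        also have "\<dots> = (\<Sum>i<n. cnj (v $ i) * (\<Sum>s<n. (w ^ s) ^ i * cnj ((w ^ s) ^ j)))"
          by (subst sum.swap) (simp add: sum_distrib_left)
        also have "\<dots> = (\<Sum>i<n. if i = j then cnj (v $ j) * of_nat n else 0)"
          by (rule sum.cong) (use j in \<open>auto simp: w_def root_unity_orthogonal simp del: complex_cnj_power\<close>)
        also have "\<dots> = cnj (v $ j) * of_nat n"
          using j by simp
        finally show ?thesis using j by simp
      qed
      then have "v = 0\<^sub>v n"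
        using v(1) by (intro eq_vecI) auto
      with v(2) show False by simp
    qed
    then show "pos_def_mat A"
      using A adj unfolding pos_def_mat_def by (auto simp: dims quad)
  qed
qed

lemma positive_collection_iff:
  "r > 0 \<Longrightarrow> positive_collection (Suc n) r \<longleftrightarrow> (\<forall>s\<le>n. poly (S_poly s (n - s)) (r\<^sup>2) > 0)"
proof -
  assume r: "r > 0"
  have "disk_matrix (Suc n) r \<in> carrier_mat (Suc n) (Suc n)"
    unfolding disk_matrix_def Let_def by (rule mat_carrier)
  then have "positive_collection (Suc n) r \<longleftrightarrow>
      (\<forall>s<Suc n. real (Suc n) * r\<^sup>2 * poly (S_poly s (n - s)) (r\<^sup>2) > 0)"
    unfolding positive_collection_def by (rule pos_def_mat_circulant[OF _ disk_matrix_entry])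
  moreover have "real (Suc n) * r\<^sup>2 > 0"
    using r by simp
  ultimately show ?thesis
    by (metis less_Suc_eq_le zero_less_mult_pos mult_pos_pos)
qed

section \<open>Comparison of the smallest zeros\<close>

text \<open>c is the minimum of the compact set of points of [a, b] where f is nonpositive; the
  intermediate value theorem rules out f c < 0.\<close>

lemma first_nonpos_point:
  fixes f :: "real \<Rightarrow> real"
  assumes cont: "\<And>x. isCont f x" and "f a > 0" "f b \<le> 0" "a < b"
  obtains c where "a < c" "c \<le> b" "f c = 0" "\<And>x. a \<le> x \<Longrightarrow> x < c \<Longrightarrow> f x > 0"
proof -
  define A where "A = {a..b} \<inter> f -` {..0}"
  have "continuous_on UNIV f"
    using cont by (simp add: continuous_on_eq_continuous_at)
  then have "closed (f -` {..0})"
    by (simp add: closed_vimage)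
  then have "compact A"
    unfolding A_def by (intro compact_Int_closed compact_Icc)
  moreover have "b \<in> A"
    using assms by (auto simp: A_def)
  then have "A \<noteq> {}"
    by blast
  ultimately obtain c where c: "c \<in> A" "\<And>x. x \<in> A \<Longrightarrow> c \<le> x"
    using compact_attains_inf by metis
  have pos: "f x > 0" if "a \<le> x" "x < c" for x
    using c that by (force simp: A_def)
  have "a \<noteq> c"
    using c assms by (auto simp: A_def)
  then have ac: "a < c"
    using c by (auto simp: A_def)
  have "f c = 0"
  proof (rule ccontr)
    assume "f c \<noteq> 0"
    then have "f c < 0"
      using c by (auto simp: A_def)
    moreover have "\<exists>x. a \<le> x \<and> x \<le> c \<and> f x = 0"
      by (rule IVT2) (use ac \<open>f c < 0\<close> assms in auto)
    ultimately show False
      using pos by (metis less_irrefl order_less_le)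
  qed
  then show thesis
    using that[of c] ac c pos by (auto simp: A_def)
qed

section \<open>Elementary values and signs, and the differential equation\<close>

lemma S_poly_at_0 [simp]: "poly (S_poly s m) 0 = 1"
  by (simp add: poly_0_coeff_0 coeff_S_poly)

lemma S_poly_0_right [simp]: "S_poly s 0 = 1"
  by (simp add: S_poly_def monom_0 one_pCons)

lemma S_poly_1_right: "S_poly s (Suc 0) = [:1, - (real (Suc s) / 2):]"
  by (rule poly_eqI) (simp add: coeff_S_poly coeff_pCons split: nat.split)

text \<open>The coefficients alternate in sign. This excludes zeros of the hypergeometric polynomial
  below -1.\<close>

lemma S_poly_pos_of_nonpos:
  assumes "t \<le> 0"
  shows "poly (S_poly s m) t > 0"
proof -
  define a where "a k = real (m choose k) * real (s + k choose k) / real (Suc k) * (- t) ^ k" for k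
  have "a k \<ge> 0" for k
    using assms unfolding a_def by (intro mult_nonneg_nonneg divide_nonneg_pos) simp_all
  then have "a 0 \<le> (\<Sum>k\<le>m. a k)"
    by (intro member_le_sum) auto
  also have "\<dots> = poly (S_poly s m) t"
    unfolding S_poly_def poly_sum poly_monom a_def
    by (rule sum.cong) (simp_all add: power_minus[of t] mult_ac)
  finally show ?thesis by (simp add: a_def)
qed

text \<open>(m + 1) t S = 1 - (1 - t)^(m + 1). The index 0 has no partner under
  \<open>S_poly_sym\<close> and needs this separate argument.\<close>

lemma S_poly_0_left_pos:
  assumes "0 < t" "t \<le> 1"
  shows "poly (S_poly 0 m) t > 0"
proof -
  have "1 - poly (U_poly 0 (Suc m)) t = poly (1 - U_poly 0 (Suc m)) t"
    by simp
  also have "\<dots> = real (Suc m) * t * poly (S_poly 0 m) t"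
    unfolding one_minus_U_poly by simp
  finally have "real (Suc m) * t * poly (S_poly 0 m) t = 1 - (1 - t) ^ Suc m"
    by (simp add: U_poly_0_left algebra_simps)
  also have "\<dots> > 0"
    using power_Suc_less_one[of "1 - t" m] assms by (cases "t = 1") auto
  finally show ?thesis
    by (rule zero_less_mult_pos) (use assms in simp)
qed

text \<open>The hypergeometric equation of \<open>S_poly s m\<close>, rewritten for f = t S with f'
  = U. No division by t remains, so coefficients can be compared.\<close>

lemma U_poly_ODE:
  "(1 - t) * poly (pderiv (U_poly s m)) t =
     (real s - real m) * poly (U_poly s m) t - real (Suc m) * real s * poly (S_poly s m) t"
proof -
  have "[:1, -1:] * pderiv (U_poly s m) =
      [:real s - real m:] * U_poly s m - [:real (Suc m) * real s:] * S_poly s m"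
  proof (rule poly_eqI)
    fix k
    define c where "c = coeff (S_poly s m) k"
    have Uk: "coeff (U_poly s m) k = real (Suc k) * c"
      by (simp add: c_def coeff_U_poly coeff_S_poly)
    have b1: "real (Suc k) * real (m choose Suc k) = (real m - real k) * real (m choose k)"
    proof -
      have "Suc k * (m choose Suc k) = (m - k) * (m choose k)"
        by (metis binomial_absorption binomial_absorb_comp)
      then show ?thesis
        by (cases "k \<le> m") (metis of_nat_diff of_nat_mult, simp add: binomial_eq_0)
    qed
    have b2: "real (Suc k) * real (s + Suc k choose Suc k) = real (s + Suc k) * real (s + k choose k)"
      using Suc_times_binomial[of k "s + k"] by (metis add_Suc_right of_nat_mult)
    have "real (Suc k) * coeff (U_poly s m) (Suc k) =
        - ((-1) ^ k) * (real (Suc k) * real (m choose Suc k)) * (real (Suc k) * real (s + Suc k choose Suc k)) / real (Suc k)"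
      unfolding coeff_U_poly by (simp del: of_nat_Suc binomial_Suc_Suc)
    also have "\<dots> = - ((real m - real k) * real (s + Suc k) * c)"
      unfolding b1 b2 by (simp add: c_def coeff_S_poly)
    finally have USuc: "real (Suc k) * coeff (U_poly s m) (Suc k) = - ((real m - real k) * real (s + Suc k) * c)" .
    have "coeff ([:1, -1:] * pderiv (U_poly s m)) k =
       real (Suc k) * coeff (U_poly s m) (Suc k) - real k * coeff (U_poly s m) k"
      by (cases k) (simp_all add: coeff_pderiv)
    also have "\<dots> = (real s - real m) * coeff (U_poly s m) k - real (Suc m) * real s * c"
      unfolding USuc Uk by (simp add: algebra_simps)
    finally show "coeff ([:1, -1:] * pderiv (U_poly s m)) k =
        coeff ([:real s - real m:] * U_poly s m - [:real (Suc m) * real s:] * S_poly s m) k"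
      by (simp add: c_def)
  qed
  then have "poly ([:1, -1:] * pderiv (U_poly s m)) t =
      poly ([:real s - real m:] * U_poly s m - [:real (Suc m) * real s:] * S_poly s m) t"
    by simp
  then show ?thesis
    by (simp add: algebra_simps)
qed

text \<open>
  Sturm comparison: with \<open>f = t S_poly (s + 1) m\<close>, \<open>g = t S_poly s (m + 1)\<close> and \<open>b = s - m - 2\<close>,
  the functions \<open>(1 - t) f\<close> and \<open>g\<close> satisfy self-adjoint equations with the same leading
  coefficient \<open>(1 - t)^(b + 1)\<close>, so their weighted Wronskian \<open>W\<close> increases as long as \<open>f\<close> and \<open>g\<close>
  are positive. At a first zero of \<open>f\<close> it would have to be nonpositive.
\<close>

lemma S_poly_pos_step:
  assumes s: "m + 2 \<le> s" and "\<tau> \<le> 1"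
    and pos: "\<And>t. 0 < t \<Longrightarrow> t < \<tau> \<Longrightarrow> poly (S_poly s (Suc m)) t > 0"
    and t: "0 < t" "t < \<tau>"
  shows "poly (S_poly (Suc s) m) t > 0"
proof (rule ccontr)
  assume "\<not> ?thesis"
  moreover have "poly (S_poly (Suc s) m) 0 > 0"
    by simp
  ultimately obtain \<sigma> where \<sigma>: "0 < \<sigma>" "\<sigma> \<le> t" "poly (S_poly (Suc s) m) \<sigma> = 0"
      "\<And>x. 0 \<le> x \<Longrightarrow> x < \<sigma> \<Longrightarrow> poly (S_poly (Suc s) m) x > 0"
    using first_nonpos_point[of "poly (S_poly (Suc s) m)" 0 t] t by (metis poly_isCont linorder_not_le)
  \<comment> \<open>\<open>m + 2 \<le> s\<close> makes this subtraction exact, so the weights (1 -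
    t)^b are polynomials.\<close>
  define b where "b = s - m - 2"
  have s': "real s = real m + real b + 2"
    using s by (simp add: b_def)
  define f g where "f = pCons 0 (S_poly (Suc s) m)" and "g = pCons 0 (S_poly s (Suc m))"
  define f' g' where "f' = U_poly (Suc s) m" and "g' = U_poly s (Suc m)"
  define h where "h x = (1 - x) * poly f x" for x
  define h' where "h' x = (1 - x) * poly f' x - poly f x" for x
  define W where "W x = (1 - x) ^ Suc b * (h' x * poly g x - h x * poly g' x)" for x
  have f': "pderiv f = f'" and g': "pderiv g = g'"
    by (simp_all only: f_def g_def f'_def g'_def pderiv_U)
  have W': "(W has_real_derivative
      (1 - x) ^ b * (real (Suc b) * x * poly (S_poly (Suc s) m) x * poly (S_poly s (Suc m)) x)) (at x)" for x
  proof -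
    define F G F1 G1 SF SG where "F = poly f' x" and "G = poly g' x" and
      "F1 = poly (pderiv f') x" and "G1 = poly (pderiv g') x" and
      "SF = poly (S_poly (Suc s) m) x" and "SG = poly (S_poly s (Suc m)) x"
    define y where "y = 1 - x"
    have x: "x = 1 - y" by (simp add: y_def)
    have fx: "poly f x = x * SF" and gx: "poly g x = x * SG"
      by (simp_all add: f_def g_def SF_def SG_def)
    have d: "(poly f has_real_derivative F) (at x)" "(poly g has_real_derivative G) (at x)"
        "(poly f' has_real_derivative F1) (at x)" "(poly g' has_real_derivative G1) (at x)"
      unfolding F_def G_def F1_def G1_def f'[symmetric] g'[symmetric] by (rule poly_DERIV)+
    \<comment> \<open>The first-order coefficients are b + 3 and b + 1; the factor 1 - x in
      \<open>h\<close> lowers the former to the latter.\<close>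
    have 1: "y * F1 = (real b + 3) * F - real (Suc m) * (real m + real b + 3) * SF"
      using U_poly_ODE[of x "Suc s" m] s' by (simp add: y_def F1_def F_def f'_def SF_def algebra_simps)
    have 2: "y * G1 = (real b + 1) * G - (real m + 2) * (real m + real b + 2) * SG"
      using U_poly_ODE[of x s "Suc m"] s' by (simp add: y_def G1_def G_def g'_def SG_def algebra_simps)
    have dh: "(h has_real_derivative h' x) (at x)"
      unfolding h_def h'_def by (auto intro!: derivative_eq_intros d simp: F_def f' algebra_simps)
    have dh': "(h' has_real_derivative y * F1 - 2 * F) (at x)"
      unfolding h'_def by (auto intro!: derivative_eq_intros d simp: F_def F1_def f' y_def algebra_simps)
    have dp: "((\<lambda>x. (1 - x) ^ Suc b) has_real_derivative - (real (Suc b) * y ^ b)) (at x)"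
    proof -
      have "((\<lambda>x. 1 - x) has_real_derivative -1) (at x)"
        by (auto intro!: derivative_eq_intros)
      from DERIV_power[OF this, of "Suc b"] show ?thesis
        by (simp add: y_def del: power_Suc of_nat_Suc)
    qed
    have "(W has_real_derivative - (real (Suc b) * y ^ b) * (h' x * poly g x - h x * poly g' x) +
        ((y * F1 - 2 * F) * poly g x + G * h' x - (h' x * poly g' x + G1 * h x)) * (1 - x) ^ Suc b) (at x)"
      unfolding W_def by (intro DERIV_mult DERIV_diff dp dh dh' d)
    also have "- (real (Suc b) * y ^ b) * (h' x * poly g x - h x * poly g' x) +
        ((y * F1 - 2 * F) * poly g x + G * h' x - (h' x * poly g' x + G1 * h x)) * (1 - x) ^ Suc b =
      y ^ b * (y * ((y * F1 - 2 * F) * poly g x - poly f x * (y * G1)) -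
        real (Suc b) * (h' x * poly g x - h x * poly g' x))"
      by (simp add: y_def[symmetric] h_def G_def[symmetric] algebra_simps)
    \<comment> \<open>(m + 2) (m + b + 2) - (m + 1) (m + b + 3) = b + 1, and x + y = 1 merges the
      two remaining terms.\<close>
    also have "\<dots> = y ^ b * (real (Suc b) * x * SF * SG)"
      unfolding 1 2 h_def h'_def fx gx F_def[symmetric] G_def[symmetric] y_def[symmetric]
      by (simp add: x algebra_simps)
    finally show ?thesis
      by (simp add: y_def SF_def SG_def)
  qed
  have "W 0 < W \<sigma>"
  proof (rule DERIV_pos_imp_increasing_open[OF \<sigma>(1)])
    fix x assume x: "0 < x" "x < \<sigma>"
    have "(1 - x) ^ b * (real (Suc b) * x * poly (S_poly (Suc s) m) x * poly (S_poly s (Suc m)) x) > 0"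
      using x \<sigma> t pos[of x] assms(2) by (intro mult_pos_pos zero_less_power) auto
    then show "\<exists>y. DERIV W x :> y \<and> 0 < y"
      using W' by blast
  next
    show "continuous_on {0..\<sigma>} W"
      using W' DERIV_isCont continuous_at_imp_continuous_on by blast
  qed
  moreover have "W 0 = 0"
    by (simp add: W_def h_def f_def g_def)
  moreover have "W \<sigma> = (1 - \<sigma>) ^ Suc (Suc b) * poly g \<sigma> * poly f' \<sigma>"
    using \<sigma>(3) by (simp add: W_def h_def h'_def f_def)
  moreover have "(1 - \<sigma>) ^ Suc (Suc b) * poly g \<sigma> > 0"
    using \<sigma> t assms pos[of \<sigma>] by (intro mult_pos_pos zero_less_power) (simp_all add: g_def)
  ultimately have "poly f' \<sigma> > 0"
    using zero_less_mult_pos by metis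
  \<comment> \<open>A positive derivative at the zero would make f negative just left of it, against
    the choice of \<open>\<sigma>\<close>.\<close>
  then have "\<exists>d>0. \<forall>h>0. h < d \<longrightarrow> poly f (\<sigma> - h) < poly f \<sigma>"
    by (intro DERIV_pos_inc_left[of "poly f"]) (use poly_DERIV[of f \<sigma>] f' in auto)
  then obtain d where d: "d > 0" "\<And>h. h > 0 \<Longrightarrow> h < d \<Longrightarrow> poly f (\<sigma> - h) < poly f \<sigma>"
    by blast
  have "poly f (\<sigma> - min d \<sigma> / 2) < 0"
    using d(2)[of "min d \<sigma> / 2"] d(1) \<sigma> by (simp add: f_def)
  moreover have "poly f (\<sigma> - min d \<sigma> / 2) > 0"
    using \<sigma>(4)[of "\<sigma> - min d \<sigma> / 2"] d(1) \<sigma>(1) by (simp add: f_def)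
  ultimately show False
    by simp
qed

text \<open>Each step keeps s + m, hence n, fixed, so positivity spreads from one index to all
  larger ones. \<open>m < s\<close> is what the first step requires; later steps have room to
  spare.\<close>

lemma S_poly_pos_steps:
  assumes "m < s" "\<tau> \<le> 1"
    and pos: "\<And>t. 0 < t \<Longrightarrow> t < \<tau> \<Longrightarrow> poly (S_poly s m) t > 0"
    and "j \<le> m" "0 < t" "t < \<tau>"
  shows "poly (S_poly (s + j) (m - j)) t > 0"
  using assms(4-6)
proof (induction j arbitrary: t)
  case 0
  then show ?case by (simp add: pos)
next
  case (Suc j)
  have "poly (S_poly (s + j) (Suc (m - Suc j))) t > 0" if "0 < t" "t < \<tau>" for t
    using Suc that by (simp add: Suc_diff_Suc)
  then have "poly (S_poly (Suc (s + j)) (m - Suc j)) t > 0"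
    using Suc assms by (intro S_poly_pos_step[of "m - Suc j" "s + j" \<tau>]) auto
  then show ?case by simp
qed

section \<open>The maximal radius as a first zero\<close>

lemma max_radius_eqI:
  assumes "0 < T" and pos: "\<And>r. 0 < r \<Longrightarrow> r\<^sup>2 < T \<Longrightarrow> positive_collection n r"
    and npos: "\<not> positive_collection n (sqrt T)"
  shows "max_radius n = ereal (sqrt T)"
  unfolding max_radius_def
proof (rule antisym)
  let ?R = "{\<rho>. \<rho> > 0 \<and> (\<forall>r\<in>{0<..<\<rho>}. positive_collection n r)}"
  have "\<rho> \<le> sqrt T" if "\<rho> \<in> ?R" for \<rho>
    using that npos \<open>0 < T\<close> by (force simp: not_le[symmetric])
  then show "(SUP \<rho>\<in>?R. ereal \<rho>) \<le> ereal (sqrt T)"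
    by (intro SUP_least) simp
  have "r\<^sup>2 < T" if "0 < r" "r < sqrt T" for r
    using that by (metis real_less_rsqrt real_sqrt_less_iff real_sqrt_unique order_less_imp_le)
  then have "sqrt T \<in> ?R"
    using pos \<open>0 < T\<close> by auto
  then show "ereal (sqrt T) \<le> (SUP \<rho>\<in>?R. ereal \<rho>)"
    by (rule SUP_upper)
qed

text \<open>For n = 2 and n = 3 the middle polynomial is the constant 1, so other indices decide:
  index 0 with 1 - t / 2 here, index 1 with 1 - t for n = 3.\<close>

lemma max_radius_2: "max_radius 2 = ereal (sqrt 2)"
proof (rule max_radius_eqI)
  have all: "(\<forall>s\<le>Suc 0. P s) \<longleftrightarrow> P 0 \<and> P (Suc 0)" for P :: "nat \<Rightarrow> bool"
    by (auto simp: le_Suc_eq)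
  have iff: "positive_collection 2 r \<longleftrightarrow> r\<^sup>2 < 2" if "r > 0" for r
    using positive_collection_iff[OF that, of 1] by (simp add: all S_poly_1_right numeral_2_eq_2[symmetric])
  show "\<not> positive_collection 2 (sqrt 2)"
    by (simp add: iff)
  show "positive_collection 2 r" if "0 < r" "r\<^sup>2 < 2" for r
    using that by (simp add: iff)
qed simp

lemma max_radius_3: "max_radius 3 = ereal 1"
proof -
  have all: "(\<forall>s\<le>2. P s) \<longleftrightarrow> P 0 \<and> P (Suc 0) \<and> P 2" for P :: "nat \<Rightarrow> bool"
    by (auto simp: le_Suc_eq numeral_2_eq_2)
  have iff: "positive_collection 3 r \<longleftrightarrow> poly (S_poly 0 2) (r\<^sup>2) > 0 \<and> r\<^sup>2 < 1" if "r > 0" for r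
    using positive_collection_iff[OF that, of 2]
    by (simp add: all S_poly_1_right)
  have "max_radius 3 = ereal (sqrt 1)"
    by (rule max_radius_eqI) (simp_all add: iff S_poly_0_left_pos)
  then show ?thesis by simp
qed

text \<open>If the middle polynomial were positive on (0, 1), so would be the one of index n - 2,
  which is 1 - (n - 1) t / 2. It vanishes at 2 / (n - 1), and n >= 4 puts this point below
  1.\<close>

lemma S_poly_middle_first_zero:
  assumes n: "n \<ge> 4"
  defines "s \<equiv> n - n div 2" and "m \<equiv> n div 2 - 1"
  obtains T where "0 < T" "T < 1" "poly (S_poly s m) T = 0"
    "\<And>t. 0 \<le> t \<Longrightarrow> t < T \<Longrightarrow> poly (S_poly s m) t > 0"
proof -
  have ms: "m < s" "m \<ge> 1" "s + (m - 1) = n - 2" "m - (m - 1) = 1"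
    using n by (auto simp: m_def s_def)
  have "\<exists>t. 0 < t \<and> t < 1 \<and> poly (S_poly s m) t \<le> 0"
  proof (rule ccontr)
    assume "\<not> ?thesis"
    then have pos: "poly (S_poly s m) t > 0" if "0 < t" "t < 1" for t
      using that by force
    have "poly (S_poly (n - 2) (Suc 0)) (2 / real (n - 1)) > 0"
      using S_poly_pos_steps[OF ms(1), of 1 "m - 1" "2 / real (n - 1)"] pos ms n by simp
    moreover have "real (Suc (n - 2)) = real (n - 1)"
      using n by simp
    ultimately show False
      using n by (simp add: S_poly_1_right)
  qed
  then obtain t where t: "0 < t" "t < 1" "poly (S_poly s m) t \<le> 0"
    by blast
  obtain T where "0 < T" "T \<le> t" "poly (S_poly s m) T = 0"
    "\<And>x. 0 \<le> x \<Longrightarrow> x < T \<Longrightarrow> poly (S_poly s m) x > 0"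
    by (rule first_nonpos_point[of "poly (S_poly s m)" 0 t]) (use t in auto)
  then show thesis
    using t that[of T] by simp
qed

text \<open>Indices from s upward are positive before T by the Sturm comparison, those strictly
  between 0 and s by symmetry, and index 0 directly.\<close>

lemma max_radius_eq_first_zero:
  assumes n: "n \<ge> 4"
  defines "s \<equiv> n - n div 2" and "m \<equiv> n div 2 - 1"
  assumes T: "0 < T" "T < 1" "poly (S_poly s m) T = 0"
    "\<And>t. 0 \<le> t \<Longrightarrow> t < T \<Longrightarrow> poly (S_poly s m) t > 0"
  shows "max_radius n = ereal (sqrt T)"
proof (rule max_radius_eqI)
  have ms: "m < s" "s + m = n - 1" "Suc (n - 1) = n" "s \<le> m + 2"
    using n by (auto simp: m_def s_def)
  have upper: "poly (S_poly i (n - 1 - i)) t > 0" if "s \<le> i" "i \<le> n - 1" "0 < t" "t < T" for i t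
  proof -
    have "poly (S_poly (s + (i - s)) (m - (i - s))) t > 0"
      using that T ms by (intro S_poly_pos_steps[OF ms(1), of T]) auto
    moreover have "s + (i - s) = i" "m - (i - s) = n - 1 - i"
      using that ms by auto
    ultimately show ?thesis by simp
  qed
  have all: "poly (S_poly i (n - 1 - i)) t > 0" if "i \<le> n - 1" "0 < t" "t < T" for i t
  proof (cases i)
    case 0
    then show ?thesis
      using that T by (auto intro: S_poly_0_left_pos)
  next
    case (Suc k)
    show ?thesis
    proof (cases "s \<le> i")
      case False
      \<comment> \<open>\<open>Suc l\<close> = n - i is the partner index under
        \<open>S_poly_sym\<close>; i < s puts it in the range already treated.\<close>
      define l where "l = n - 1 - i"
      have l: "s \<le> Suc l" "Suc l \<le> n - 1" "n - 1 - Suc l = k"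
        using False Suc that ms by (auto simp: l_def)
      have "(1 - t) ^ Suc k * poly (S_poly (Suc k) l) t = (1 - t) ^ Suc l * poly (S_poly (Suc l) k) t"
        using that by (intro S_poly_sym) simp
      also have "\<dots> > 0"
        using upper[OF l(1,2) that(2,3)] that T unfolding l(3) by (intro mult_pos_pos zero_less_power) auto
      finally have "poly (S_poly (Suc k) l) t > 0"
        by (rule zero_less_mult_pos) (use that T in \<open>intro zero_less_power, simp\<close>)
      then show ?thesis
        by (simp add: Suc l_def)
    qed (use upper that in auto)
  qed
  have iff: "positive_collection n r \<longleftrightarrow> (\<forall>i\<le>n - 1. poly (S_poly i (n - 1 - i)) (r\<^sup>2) > 0)" if "r > 0" for r
    using positive_collection_iff[OF that, of "n - 1"] unfolding ms(3) .
  show "positive_collection n r" if "0 < r" "r\<^sup>2 < T" for r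
    using all that unfolding iff[OF that(1)] by auto
  have "s \<le> n - 1 \<and> n - 1 - s = m"
    using ms by auto
  then show "\<not> positive_collection n (sqrt T)"
    using T iff[of "sqrt T"] by force
qed (rule T)

text \<open>Zeros z other than -1 correspond to zeros t = 1 + z of the middle polynomial, which is
  positive for t < T; T > 0 gives T - 1 > -1.\<close>

lemma smallest_zero_hypergeo_poly:
  assumes n: "n \<ge> 4"
  defines "s \<equiv> n - n div 2" and "m \<equiv> n div 2 - 1"
  assumes T: "0 < T" "poly (S_poly s m) T = 0"
    "\<And>t. 0 \<le> t \<Longrightarrow> t < T \<Longrightarrow> poly (S_poly s m) t > 0"
  shows "is_smallest_zero_ne_neg1 (hypergeo_poly n) (T - 1)"
proof -
  define k where "k = s - 1"
  have k: "s = Suc k" "m \<le> k" "k \<le> Suc m" "Suc k + Suc m = n" "Suc m \<le> n"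
    using n by (auto simp: m_def s_def k_def)
  have "poly (hypergeo_poly n) z = 0 \<longleftrightarrow> z = -1 \<or> poly (S_poly s m) (1 + z) = 0" for z
  proof -
    have c: "real (n choose Suc m) * poly (hypergeo_poly n) z =
        (-1) ^ m * real n * (1 + z) * poly (S_poly s m) (1 + z)"
      using hypergeo_poly_eq_S_poly[OF k(2,3), of z] unfolding k(4) k(1) .
    have "n choose Suc m > 0"
      using k by (intro zero_less_binomial) auto
    then have "poly (hypergeo_poly n) z = 0 \<longleftrightarrow> real (n choose Suc m) * poly (hypergeo_poly n) z = 0"
      by simp
    also have "\<dots> \<longleftrightarrow> 1 + z = 0 \<or> poly (S_poly s m) (1 + z) = 0"
      unfolding c using n by simp
    also have "1 + z = 0 \<longleftrightarrow> z = -1"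
      by linarith
    finally show ?thesis .
  qed
  moreover have "T \<le> t" if "poly (S_poly s m) t = 0" for t
    using that T(3)[of t] S_poly_pos_of_nonpos[of t s m] by (metis less_irrefl linorder_not_le order_less_imp_le)
  ultimately show ?thesis
    using T by (auto simp: is_smallest_zero_ne_neg1_def) fastforce
qed

section \<open>The Bessel limit\<close>

definition bessel_coeff :: "nat \<Rightarrow> real" where
  "bessel_coeff k = (-1) ^ k / (fact k * fact (Suc k))"

definition bessel_series :: "real \<Rightarrow> real" where
  "bessel_series u = (\<Sum>k. bessel_coeff k * u ^ k)"

lemma bessel_J_1: "bessel_J 1 x = x / 2 * bessel_series ((x / 2)\<^sup>2)"
proof -
  have "Gamma (real m + real 1 + 1) = fact (Suc m)" for m
    using Gamma_fact[of "Suc m", where 'a = real] by (simp add: add_ac)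
  then show ?thesis
    by (simp add: bessel_J_def bessel_series_def bessel_coeff_def power_mult del: fact_Suc)
qed

lemma abs_bessel_coeff_le: "\<bar>bessel_coeff k\<bar> \<le> 1 / fact k"
proof -
  have "(1::real) \<le> fact (Suc k)"
    by (rule fact_ge_1)
  then have "fact k * 1 \<le> (fact k * fact (Suc k) :: real)"
    by (intro mult_left_mono) auto
  then show ?thesis
    unfolding bessel_coeff_def by (simp add: abs_mult power_abs frac_le del: fact_Suc)
qed

lemma summable_bessel_series: "summable (\<lambda>k. bessel_coeff k * u ^ k)"
proof (rule summable_comparison_test')
  show "summable (\<lambda>k. \<bar>u\<bar> ^ k / fact k)"
    using summable_exp[of "\<bar>u\<bar>"] by (simp add: field_simps)
  show "norm (bessel_coeff k * u ^ k) \<le> \<bar>u\<bar> ^ k / fact k" for k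
    using mult_right_mono[OF abs_bessel_coeff_le[of k], of "\<bar>u\<bar> ^ k"]
    by (simp add: abs_mult power_abs)
qed

lemma DERIV_bessel_series:
  "(bessel_series has_real_derivative (\<Sum>k. diffs bessel_coeff k * u ^ k)) (at u)"
  unfolding bessel_series_def[abs_def]
  by (rule termdiffs_strong_converges_everywhere[OF summable_bessel_series])

text \<open>The first term is exempt from the monotonicity assumption, because the terms of the Bessel
  series only decrease from the second one on when the argument is larger than 2.\<close>

lemma alternating_series_bounds:
  fixes a :: "nat \<Rightarrow> real"
  assumes "summable (\<lambda>k. (-1) ^ k * a k)" and nonneg: "\<And>k. 0 \<le> a k"
    and dec: "\<And>k. a (Suc (Suc k)) \<le> a (Suc k)"
  shows "(\<Sum>k. (-1) ^ k * a k) \<ge> (\<Sum>k<2 * N + 2. (-1) ^ k * a k)"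
    and "(\<Sum>k. (-1) ^ k * a k) \<le> (\<Sum>k<2 * N + 1. (-1) ^ k * a k)"
proof -
  have "(\<lambda>k. norm ((-1) ^ k * a k)) \<longlonglongrightarrow> 0"
    using summable_LIMSEQ_zero[OF assms(1)] by (rule tendsto_norm_zero)
  then have "a \<longlonglongrightarrow> 0"
    using nonneg by (simp add: abs_mult power_abs)
  then have lim: "(\<lambda>k. a (Suc k)) \<longlonglongrightarrow> 0"
    by (rule LIMSEQ_Suc)
  \<comment> \<open>Leibniz is applied to the tail from index 1, which enters with a minus sign, so
    upper and lower bounds exchange roles.\<close>
  note L = summable_Leibniz'[OF lim nonneg dec]
  have split: "(\<Sum>k. (-1) ^ k * a k) = a 0 - (\<Sum>k. (-1) ^ k * a (Suc k))"
    using suminf_split_head[OF assms(1)] suminf_minus[OF L(1)] by simp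
  have part: "(\<Sum>k<Suc M. (-1) ^ k * a k) = a 0 - (\<Sum>k<M. (-1) ^ k * a (Suc k))" for M
    by (subst sum.lessThan_Suc_shift) (simp add: sum_negf)
  show "(\<Sum>k. (-1) ^ k * a k) \<ge> (\<Sum>k<2 * N + 2. (-1) ^ k * a k)"
    using L(4)[of N] part[of "2 * N + 1"] split by simp
  show "(\<Sum>k. (-1) ^ k * a k) \<le> (\<Sum>k<2 * N + 1. (-1) ^ k * a k)"
    using L(2)[of N] part[of "2 * N"] split by simp
qed

text \<open>From the second term on, consecutive terms have ratio at most u / (2 * 3), whence the
  limit 6.\<close>

lemma bessel_series_bounds:
  assumes u: "0 \<le> u" "u \<le> 6"
  shows "bessel_series u \<ge> (\<Sum>k<2 * N + 2. bessel_coeff k * u ^ k)"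
    and "bessel_series u \<le> (\<Sum>k<2 * N + 1. bessel_coeff k * u ^ k)"
proof -
  define a where "a k = u ^ k / (fact k * fact (Suc k))" for k
  have a: "bessel_coeff k * u ^ k = (-1) ^ k * a k" for k
    by (simp add: bessel_coeff_def a_def)
  have dec: "a (Suc (Suc k)) \<le> a (Suc k)" for k
  proof -
    have "a (Suc (Suc k)) = a (Suc k) * (u / (real (k + 2) * real (k + 3)))"
      by (simp add: a_def field_simps)
    also have "\<dots> \<le> a (Suc k) * 1"
    proof (rule mult_left_mono)
      have "2 * 3 \<le> real (k + 2) * real (k + 3)"
        by (intro mult_mono) auto
      then show "u / (real (k + 2) * real (k + 3)) \<le> 1"
        using u by (simp add: divide_le_eq_1)
    qed (use u in \<open>simp add: a_def\<close>)
    finally show ?thesis by simp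
  qed
  have sm: "summable (\<lambda>k. (-1) ^ k * a k)"
    using summable_bessel_series[of u] unfolding a .
  have nonneg: "0 \<le> a k" for k
    using u by (simp add: a_def)
  note B = alternating_series_bounds[OF sm nonneg dec, of N]
  show "bessel_series u \<ge> (\<Sum>k<2 * N + 2. bessel_coeff k * u ^ k)"
    "bessel_series u \<le> (\<Sum>k<2 * N + 1. bessel_coeff k * u ^ k)"
    using B by (simp_all only: bessel_series_def a)
qed

text \<open>Four terms of the alternating series of the negated derivative already have a positive
  sum on [0, 4], an interval that contains the first zero.\<close>

lemma bessel_series_deriv_neg:
  assumes u: "0 \<le> u" "u \<le> 4"
  shows "(\<Sum>k. diffs bessel_coeff k * u ^ k) < 0"
proof -
  define a where "a k = u ^ k / (fact k * fact (Suc (Suc k)))" for k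
  have a: "- (diffs bessel_coeff k * u ^ k) = (-1) ^ k * a k" for k
    by (simp add: diffs_def bessel_coeff_def a_def divide_simps)
  have dec: "a (Suc (Suc k)) \<le> a (Suc k)" for k
  proof -
    have "a (Suc (Suc k)) = a (Suc k) * (u / (real (k + 2) * real (k + 4)))"
      by (simp add: a_def field_simps)
    also have "\<dots> \<le> a (Suc k) * 1"
    proof (rule mult_left_mono)
      have "2 * 4 \<le> real (k + 2) * real (k + 4)"
        by (intro mult_mono) auto
      then show "u / (real (k + 2) * real (k + 4)) \<le> 1"
        using u by (simp add: divide_le_eq_1)
    qed (use u in \<open>simp add: a_def\<close>)
    finally show ?thesis by simp
  qed
  have sm: "summable (\<lambda>k. diffs bessel_coeff k * u ^ k)"
    by (rule termdiff_converges_all) (rule summable_bessel_series)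
  have sm': "summable (\<lambda>k. (-1) ^ k * a k)"
    using summable_minus[OF sm] unfolding a .
  have "a k \<ge> 0" for k
    using u by (simp add: a_def)
  from alternating_series_bounds(1)[OF sm' this dec, of 1]
  have "(\<Sum>k<4. (-1) ^ k * a k) \<le> (\<Sum>k. (-1) ^ k * a k)"
    by simp
  moreover have "(\<Sum>k<4. (-1) ^ k * a k) = ((u - 4)\<^sup>2 + 8) / 48 - u ^ 3 / 720"
    by (simp add: eval_nat_numeral a_def field_simps)
  moreover have "((u - 4)\<^sup>2 + 8) / 48 - u ^ 3 / 720 > 0"
  proof -
    have "u ^ 3 \<le> 64"
      using power_mono[of u 4 3] u by simp
    then have "u ^ 3 / 720 \<le> 64 / 720"
      by simp
    moreover have "8 / 48 \<le> ((u - 4)\<^sup>2 + 8) / 48"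
      by simp
    ultimately show ?thesis
      by linarith
  qed
  ultimately have "(\<Sum>k. (-1) ^ k * a k) > 0"
    by linarith
  moreover have "(\<Sum>k. (-1) ^ k * a k) = - (\<Sum>k. diffs bessel_coeff k * u ^ k)"
    using suminf_minus[OF sm] by (simp only: a)
  ultimately show ?thesis by simp
qed

lemma bessel_series_strict_antimono:
  assumes "0 \<le> u" "u < v" "v \<le> 4"
  shows "bessel_series v < bessel_series u"
  by (rule DERIV_neg_imp_decreasing[OF assms(2)])
    (use assms DERIV_bessel_series bessel_series_deriv_neg in \<open>meson order_trans\<close>)

text \<open>Truncations after 10 and 11 terms give opposite signs at the two rational points, which
  approximate j^2 / 4 closely enough for six decimals of j. Monotonicity excludes an earlier
  zero.\<close>

lemma bessel_series_first_zero:
  obtains u where "3.670492 < u" "u \<le> 3.670493" "bessel_series u = 0"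
    "\<And>v. 0 \<le> v \<Longrightarrow> v < u \<Longrightarrow> bessel_series v > 0"
proof -
  have "(0::real) < (\<Sum>k<2 * 4 + 2. bessel_coeff k * 3.670492 ^ k)"
    by (simp add: eval_nat_numeral bessel_coeff_def)
  also have "\<dots> \<le> bessel_series 3.670492"
    by (rule bessel_series_bounds) auto
  finally have lo: "bessel_series 3.670492 > 0" .
  have "bessel_series 3.670493 \<le> (\<Sum>k<2 * 5 + 1. bessel_coeff k * 3.670493 ^ k)"
    by (rule bessel_series_bounds) auto
  also have "\<dots> < 0"
    by (simp add: eval_nat_numeral bessel_coeff_def)
  finally have hi: "bessel_series 3.670493 \<le> 0" by simp
  have "bessel_series 0 = 1"
    unfolding bessel_series_def powser_zero by (simp add: bessel_coeff_def)
  then have "bessel_series 0 > 0"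
    by simp
  obtain u where u: "0 < u" "u \<le> 3.670493" "bessel_series u = 0"
    "\<And>v. 0 \<le> v \<Longrightarrow> v < u \<Longrightarrow> bessel_series v > 0"
  proof (rule first_nonpos_point[of bessel_series 0 "3.670493"])
    show "isCont bessel_series x" for x
      using DERIV_bessel_series DERIV_isCont by blast
  qed (use \<open>bessel_series 0 > 0\<close> hi in auto)
  moreover have "3.670492 < u"
  proof (rule ccontr)
    assume *: "\<not> 3.670492 < u"
    then have "u \<noteq> 3.670492"
      using lo u(3) by (metis less_irrefl)
    then have "bessel_series 3.670492 < bessel_series u"
      using * u by (intro bessel_series_strict_antimono) auto
    then show False
      using lo u(3) by simp
  qed
  ultimately show thesis
    using that by blast
qed

section \<open>Convergence of the rescaled middle polynomials\<close>

lemma tendsto_binomial_div_power: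
  fixes f :: "nat \<Rightarrow> nat"
  assumes "(\<lambda>n. real (f n) / real n) \<longlonglongrightarrow> L"
  shows "(\<lambda>n. real (f n choose k) / real n ^ k) \<longlonglongrightarrow> L ^ k / fact k"
proof -
  have "(\<lambda>n. (real (f n) - real i) / real n) \<longlonglongrightarrow> L" for i
    using tendsto_diff[OF assms lim_const_over_n[of "real i"]] by (simp add: diff_divide_distrib)
  then have "(\<lambda>n. (\<Prod>i=0..<k. (real (f n) - real i) / real n) / fact k) \<longlonglongrightarrow> (\<Prod>i=0..<k. L) / fact k"
    by (intro tendsto_divide tendsto_prod tendsto_const) auto
  moreover have "real (f n choose k) / real n ^ k = (\<Prod>i=0..<k. (real (f n) - real i) / real n) / fact k" for n
    unfolding binomial_gbinomial gbinomial_prod_rev by (simp add: prod_dividef)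
  ultimately show ?thesis
    by simp
qed

lemma binomial_le_power_div_fact: "real (n choose k) \<le> real n ^ k / fact k"
proof -
  have "real ((n choose k) * fact k) \<le> real (n ^ k)"
    using binomial_fact_pow by (simp only: of_nat_le_iff)
  then show ?thesis
    by (simp only: of_nat_mult of_nat_power of_nat_fact) (simp add: field_simps)
qed

text \<open>A majorant independent of n, for Tannery's theorem: the binomials are at most (n / 2)^k
  / k! and n^k, and the scaling leaves 2^k / k!.\<close>

lemma S_poly_middle_scaled_coeff_bound:
  assumes "n > 0"
  shows "\<bar>coeff (S_poly (n - n div 2) (n div 2 - 1)) k * (4 / (real n)\<^sup>2) ^ k\<bar> \<le> 2 ^ k / fact k"
proof (cases "k \<le> n div 2 - 1")
  case False
  then show ?thesis
    by (simp add: coeff_S_poly binomial_eq_0)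
next
  case True
  define m s where "m = n div 2 - 1" and "s = n - n div 2"
  have km: "k \<le> m" "s + k \<le> n" "2 * m \<le> n"
    using True assms by (auto simp: m_def s_def)
  have "real (m choose k) \<le> real m ^ k / fact k"
    by (rule binomial_le_power_div_fact)
  also have "\<dots> \<le> (real n / 2) ^ k / fact k"
    using km by (intro divide_right_mono power_mono) auto
  finally have 1: "real (m choose k) \<le> (real n / 2) ^ k / fact k" .
  have "real (s + k choose k) \<le> real (s + k) ^ k / fact k"
    by (rule binomial_le_power_div_fact)
  also have "\<dots> \<le> real n ^ k / 1"
    using km by (intro frac_le power_mono fact_ge_1) auto
  finally have 2: "real (s + k choose k) \<le> real n ^ k"
    by simp
  have "real (m choose k) * real (s + k choose k) / real (Suc k) \<le> real (m choose k) * real (s + k choose k) / 1"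
    by (intro divide_left_mono) auto
  also have "\<dots> \<le> (real n / 2) ^ k / fact k * real n ^ k / 1"
    by (intro divide_right_mono mult_mono 1 2) auto
  finally have "\<bar>coeff (S_poly s m) k\<bar> \<le> (real n / 2) ^ k / fact k * real n ^ k"
    by (simp add: coeff_S_poly abs_mult power_abs)
  then have "\<bar>coeff (S_poly s m) k\<bar> * (4 / (real n)\<^sup>2) ^ k \<le>
      (real n / 2) ^ k / fact k * real n ^ k * (4 / (real n)\<^sup>2) ^ k"
    by (intro mult_right_mono) auto
  also have "\<dots> = (real n / 2 * real n * (4 / (real n)\<^sup>2)) ^ k / fact k"
    by (simp only: power_mult_distrib) simp
  also have "real n / 2 * real n * (4 / (real n)\<^sup>2) = 2"
    using assms by (simp add: power2_eq_square)
  finally show ?thesis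
    by (simp add: abs_mult m_def s_def)
qed

text \<open>Both upper binomial entries are n / 2 up to a bounded error, so each binomial over n^k
  tends to (1 / 2)^k / k!; the factor 4^k cancels the powers of 1 / 2.\<close>

lemma tendsto_S_poly_middle_scaled_coeff:
  "(\<lambda>n. coeff (S_poly (n - n div 2) (n div 2 - 1)) k * (4 / (real n)\<^sup>2) ^ k) \<longlonglongrightarrow> bessel_coeff k"
proof -
  have half: "(\<lambda>n. real (f n) / real n) \<longlonglongrightarrow> 1 / 2" 
    if f: "\<And>n. n \<le> 2 * f n + c" "\<And>n. 2 * f n \<le> n + c" for f :: "nat \<Rightarrow> nat" and c
  proof -
    have abs: "\<bar>2 * real (f n) - real n\<bar> \<le> real c" for n
    proof -
      have "real n \<le> real (2 * f n + c)" "real (2 * f n) \<le> real (n + c)"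
        using f by (simp_all only: of_nat_le_iff)
      then show ?thesis by simp
    qed
    have "(\<lambda>n. real (f n) / real n - 1 / 2) \<longlonglongrightarrow> 0"
    proof (rule Lim_null_comparison)
      show "\<forall>\<^sub>F n in sequentially. norm (real (f n) / real n - 1 / 2) \<le> real c / real n"
      proof (rule eventually_sequentiallyI[of 1])
        fix n :: nat assume "1 \<le> n"
        then have "real (f n) / real n - 1 / 2 = (2 * real (f n) - real n) / (2 * real n)"
          by (simp add: field_simps)
        then have "norm (real (f n) / real n - 1 / 2) = \<bar>2 * real (f n) - real n\<bar> / (2 * real n)"
          by simp
        also have "\<dots> \<le> real c / real n"
          using abs[of n] \<open>1 \<le> n\<close> by (intro frac_le) auto
        finally show "norm (real (f n) / real n - 1 / 2) \<le> real c / real n" .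
      qed
      show "(\<lambda>n. real c / real n) \<longlonglongrightarrow> 0"
        by (rule lim_const_over_n)
    qed
    then show ?thesis
      by (simp add: LIM_zero_iff)
  qed
  have 1: "(\<lambda>n. real (n div 2 - 1 choose k) / real n ^ k) \<longlonglongrightarrow> (1 / 2) ^ k / fact k"
    by (rule tendsto_binomial_div_power, rule half[of _ 3]) auto
  have 2: "(\<lambda>n. real (n - n div 2 + k choose k) / real n ^ k) \<longlonglongrightarrow> (1 / 2) ^ k / fact k"
    by (rule tendsto_binomial_div_power, rule half[of _ "2 * k + 1"]) auto
  have "(\<lambda>n. (-1) ^ k * 4 ^ k / real (Suc k) * (real (n div 2 - 1 choose k) / real n ^ k *
      (real (n - n div 2 + k choose k) / real n ^ k))) \<longlonglongrightarrow>
      (-1) ^ k * 4 ^ k / real (Suc k) * ((1 / 2) ^ k / fact k * ((1 / 2) ^ k / fact k))"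
    by (intro tendsto_mult tendsto_const 1 2)
  also have "(-1) ^ k * 4 ^ k / real (Suc k) * ((1 / 2) ^ k / fact k * ((1 / 2) ^ k / fact k)) =
      ((-1) ^ k * (4 * (1 / 2) * (1 / 2)) ^ k) / (real (Suc k) * fact k * fact k)"
    by (simp only: power_mult_distrib) simp
  also have "\<dots> = bessel_coeff k"
    by (simp add: bessel_coeff_def mult_ac)
  finally show ?thesis
    by (simp add: coeff_S_poly power_divide power2_eq_square power_mult_distrib mult_ac)
qed

text \<open>Tannery's theorem for the coefficient distances weighted by 4^k: since 4^k dominates
  u^k, a single limit gives uniformity on [0, 4].\<close>

lemma S_poly_middle_approx:
  assumes "\<delta> > 0"
  shows "\<forall>\<^sub>F n in sequentially. \<forall>u\<in>{0..4}.
    \<bar>poly (S_poly (n - n div 2) (n div 2 - 1)) (4 / (real n)\<^sup>2 * u) - bessel_series u\<bar> < \<delta>"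
proof -
  define p where "p n = S_poly (n - n div 2) (n div 2 - 1)" for n
  define a where "a k n = coeff (p n) k * (4 / (real n)\<^sup>2) ^ k" for k n
  have M: "\<bar>a k n - bessel_coeff k\<bar> * 4 ^ k \<le> 2 * (8 ^ k / fact k)" if "n > 0" for k n
  proof -
    have "\<bar>a k n\<bar> \<le> 2 ^ k / fact k"
      unfolding a_def p_def by (rule S_poly_middle_scaled_coeff_bound[OF that])
    moreover have "\<bar>bessel_coeff k\<bar> \<le> 2 ^ k / fact k"
      by (rule order_trans[OF abs_bessel_coeff_le]) (simp add: divide_right_mono)
    ultimately have "\<bar>a k n - bessel_coeff k\<bar> \<le> 2 * (2 ^ k / fact k)"
      by linarith
    then have "\<bar>a k n - bessel_coeff k\<bar> * 4 ^ k \<le> 2 * (2 ^ k / fact k) * 4 ^ k"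
      by (rule mult_right_mono) simp
    also have "\<dots> = 2 * ((2 * 4) ^ k / fact k)"
      by (simp only: power_mult_distrib) simp
    finally show ?thesis by simp
  qed
  have sM: "summable (\<lambda>k. 2 * (8 ^ k / fact k) :: real)"
    using summable_exp[of "8::real"] by (intro summable_mult) (simp add: field_simps)
  have "eventually (\<lambda>n. summable (\<lambda>k. norm (\<bar>a k n - bessel_coeff k\<bar> * 4 ^ k))) sequentially \<and>
      summable (\<lambda>k. norm (0::real)) \<and>
      ((\<lambda>n. \<Sum>k. \<bar>a k n - bessel_coeff k\<bar> * 4 ^ k) \<longlongrightarrow> (\<Sum>k. 0)) sequentially"
  proof (rule tannerys_theorem)
    show "(\<lambda>n. \<bar>a k n - bessel_coeff k\<bar> * 4 ^ k) \<longlonglongrightarrow> 0" for k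
      using tendsto_S_poly_middle_scaled_coeff[of k] unfolding a_def p_def
      by (intro tendsto_mult_left_zero tendsto_rabs_zero) (simp add: LIM_zero)
    show "\<forall>\<^sub>F (k, n) in at_top \<times>\<^sub>F sequentially. norm (\<bar>a k n - bessel_coeff k\<bar> * 4 ^ k) \<le> 2 * (8 ^ k / fact k)"
      unfolding eventually_prod_sequentially
      by (intro exI[of _ 1]) (use M in auto)
  qed (use sM in auto)
  then have "(\<lambda>n. \<Sum>k. \<bar>a k n - bessel_coeff k\<bar> * 4 ^ k) \<longlonglongrightarrow> 0"
    by simp
  then have "\<forall>\<^sub>F n in sequentially. (\<Sum>k. \<bar>a k n - bessel_coeff k\<bar> * 4 ^ k) < \<delta>"
    using assms by (rule order_tendstoD)
  then show ?thesis
    using eventually_gt_at_top[of 0]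
  proof eventually_elim
    case (elim n)
    show ?case
    proof
      fix u :: real assume u: "u \<in> {0..4}"
      have "(\<lambda>k. a k n * u ^ k) sums poly (p n) (4 / (real n)\<^sup>2 * u)"
      proof -
        have "(\<lambda>k. a k n * u ^ k) sums (\<Sum>k\<le>degree (p n). a k n * u ^ k)"
          by (rule sums_finite) (auto simp: a_def coeff_eq_0)
        then show ?thesis
          unfolding poly_altdef power_mult_distrib a_def by (simp only: mult.assoc)
      qed
      moreover have "(\<lambda>k. bessel_coeff k * u ^ k) sums bessel_series u"
        unfolding bessel_series_def by (rule summable_sums[OF summable_bessel_series])
      ultimately have sums: "(\<lambda>k. (a k n - bessel_coeff k) * u ^ k) sums
          (poly (p n) (4 / (real n)\<^sup>2 * u) - bessel_series u)"
        unfolding left_diff_distrib by (rule sums_diff)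
      have sN: "summable (\<lambda>k. \<bar>a k n - bessel_coeff k\<bar> * 4 ^ k)"
        by (rule summable_comparison_test'[OF sM, of 0]) (use M elim in simp)
      have le: "norm ((a k n - bessel_coeff k) * u ^ k) \<le> \<bar>a k n - bessel_coeff k\<bar> * 4 ^ k" for k
        using u by (simp add: abs_mult power_abs mult_left_mono power_mono)
      have "norm (\<Sum>k. (a k n - bessel_coeff k) * u ^ k) \<le> (\<Sum>k. \<bar>a k n - bessel_coeff k\<bar> * 4 ^ k)"
        by (rule norm_suminf_le[OF le sN])
      then show "\<bar>poly (S_poly (n - n div 2) (n div 2 - 1)) (4 / (real n)\<^sup>2 * u) - bessel_series u\<bar> < \<delta>"
        using elim sums_unique[OF sums] by (simp add: p_def)
    qed
  qed
qed

text \<open>Below u the limit is positive and decreasing, so uniform closeness forbids a zero up to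
  w; above u it is negative, so the polynomial has turned negative by w. The lower bound needs
  uniformity because the zero moves with n.\<close>

lemma tendsto_scaled_first_zero:
  assumes T: "\<And>n. n \<ge> 4 \<Longrightarrow> 0 < T n"
    "\<And>n. n \<ge> 4 \<Longrightarrow> poly (S_poly (n - n div 2) (n div 2 - 1)) (T n) = 0"
    "\<And>n t. n \<ge> 4 \<Longrightarrow> 0 \<le> t \<Longrightarrow> t < T n \<Longrightarrow> poly (S_poly (n - n div 2) (n div 2 - 1)) t > 0"
  and u: "0 < u" "u < 4" "bessel_series u = 0" "\<And>v. 0 \<le> v \<Longrightarrow> v < u \<Longrightarrow> bessel_series v > 0"
  shows "(\<lambda>n. (real n)\<^sup>2 / 4 * T n) \<longlonglongrightarrow> u"
proof (rule order_tendstoI)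
  fix v assume v: "v < u"
  \<comment> \<open>Clipping to [0, 4], here and in the other half, stays where approximation and
    monotonicity are available.\<close>
  define w where "w = max v 0"
  have w: "0 \<le> w" "w < u" "v \<le> w"
    using v u by (auto simp: w_def)
  have "bessel_series w > 0"
    using w u by simp
  from S_poly_middle_approx[OF this] show "\<forall>\<^sub>F n in sequentially. v < (real n)\<^sup>2 / 4 * T n"
    using eventually_ge_at_top[of 4]
  proof eventually_elim
    case (elim n)
    show ?case
    proof (rule ccontr)
      define x where "x = (real n)\<^sup>2 / 4 * T n"
      assume "\<not> v < (real n)\<^sup>2 / 4 * T n"
      then have x: "0 \<le> x" "x \<le> w"
        using w T(1)[of n] elim by (auto simp: x_def)
      have "4 / (real n)\<^sup>2 * x = T n"
        using elim by (simp add: x_def)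
      then have "\<bar>0 - bessel_series x\<bar> < bessel_series w"
        using elim x w u T(2)[of n] by (metis atLeastAtMost_iff order_trans less_imp_le)
      moreover have "bessel_series w \<le> bessel_series x"
        using bessel_series_strict_antimono[of x w] x w u by (cases "x = w") auto
      ultimately show False
        by linarith
    qed
  qed
next
  fix v assume v: "u < v"
  define w where "w = min v 4"
  have w: "u < w" "w \<le> 4" "w \<le> v"
    using v u by (auto simp: w_def)
  have "- bessel_series w > 0"
    using bessel_series_strict_antimono[of u w] u w by simp
  from S_poly_middle_approx[OF this] show "\<forall>\<^sub>F n in sequentially. (real n)\<^sup>2 / 4 * T n < v"
    using eventually_ge_at_top[of 4]
  proof eventually_elim
    case (elim n)
    define p where "p = S_poly (n - n div 2) (n div 2 - 1)"
    have "\<bar>poly p (4 / (real n)\<^sup>2 * w) - bessel_series w\<bar> < - bessel_series w"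
      using elim w u by (simp add: p_def)
    then have "poly p (4 / (real n)\<^sup>2 * w) < 0"
      by linarith
    then have "T n \<le> 4 / (real n)\<^sup>2 * w"
      using T(3)[of n "4 / (real n)\<^sup>2 * w"] elim w u unfolding p_def by force
    then have "T n \<noteq> 4 / (real n)\<^sup>2 * w \<Longrightarrow> T n < 4 / (real n)\<^sup>2 * w"
      by simp
    moreover have "T n \<noteq> 4 / (real n)\<^sup>2 * w"
      using T(2)[of n] elim \<open>poly p _ < 0\<close> unfolding p_def by auto
    ultimately have "(real n)\<^sup>2 / 4 * T n < (real n)\<^sup>2 / 4 * (4 / (real n)\<^sup>2 * w)"
      using elim by (intro mult_strict_left_mono) auto
    also have "\<dots> = w"
      using elim by simp
    finally show ?case
      using w by simp
  qed
qed

theorem theorem1: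
  shows "max_radius 2 = ereal (sqrt 2) \<and>
    max_radius 3 = ereal 1 \<and>
    (\<forall>n\<ge>4. \<exists>\<mu>. is_smallest_zero_ne_neg1 (hypergeo_poly n) \<mu> \<and>
               max_radius n = ereal (sqrt (1 + \<mu>))) \<and>
    (\<exists>j. is_first_pos_zero (bessel_J 1) j \<and>
         \<bar>j - 3.831706\<bar> \<le> 5 * 10 powi (-7) \<and>
         (\<lambda>n. ereal (real n) * max_radius n) \<longlonglongrightarrow> ereal j)"
proof -
  have "\<exists>T. 0 < T \<and> T < 1 \<and> poly (S_poly (n - n div 2) (n div 2 - 1)) T = 0 \<and>
      (\<forall>t. 0 \<le> t \<longrightarrow> t < T \<longrightarrow> poly (S_poly (n - n div 2) (n div 2 - 1)) t > 0)" if "n \<ge> 4" for n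
    using S_poly_middle_first_zero[OF that] by metis
  then obtain T where T: "\<And>n. n \<ge> 4 \<Longrightarrow> 0 < T n" "\<And>n. n \<ge> 4 \<Longrightarrow> T n < 1"
    "\<And>n. n \<ge> 4 \<Longrightarrow> poly (S_poly (n - n div 2) (n div 2 - 1)) (T n) = 0"
    "\<And>n t. n \<ge> 4 \<Longrightarrow> 0 \<le> t \<Longrightarrow> t < T n \<Longrightarrow> poly (S_poly (n - n div 2) (n div 2 - 1)) t > 0"
    by metis
  have radius: "max_radius n = ereal (sqrt (T n))" if "n \<ge> 4" for n
    using that by (intro max_radius_eq_first_zero T)
  have zeros: "is_smallest_zero_ne_neg1 (hypergeo_poly n) (T n - 1)" if "n \<ge> 4" for n
    using that by (intro smallest_zero_hypergeo_poly T)
  obtain u where u: "3.670492 < u" "u \<le> 3.670493" "bessel_series u = 0"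
    "\<And>v. 0 \<le> v \<Longrightarrow> v < u \<Longrightarrow> bessel_series v > 0"
    using bessel_series_first_zero by blast
  define j where "j = 2 * sqrt u"
  have j2: "(j / 2)\<^sup>2 = u" and j0: "j > 0"
    using u by (simp_all add: j_def)
  have first: "is_first_pos_zero (bessel_J 1) j"
  proof -
    have "bessel_J 1 x \<noteq> 0" if "0 < x" "x < j" for x
    proof -
      have "(x / 2)\<^sup>2 < (j / 2)\<^sup>2"
        using that by (intro power_strict_mono) auto
      then have "bessel_series ((x / 2)\<^sup>2) > 0"
        unfolding j2 by (intro u(4)) auto
      then show ?thesis
        using that by (simp add: bessel_J_1 del: One_nat_def)
    qed
    then show ?thesis
      using j0 u(3) by (simp add: is_first_pos_zero_def bessel_J_1 j2 del: One_nat_def)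
  qed
  \<comment> \<open>Squaring reduces both bounds to rational comparisons with the bracket for u = (j
    / 2)^2.\<close>
  have "3.8317055 / 2 < j / 2"
    by (rule power_less_imp_less_base[of _ 2]) (use j0 j2 u in \<open>simp_all add: power2_eq_square\<close>)
  moreover have "j / 2 < 3.8317065 / 2"
    by (rule power_less_imp_less_base[of _ 2]) (use j2 u in \<open>simp_all add: power2_eq_square\<close>)
  ultimately have bound: "\<bar>j - 3.831706\<bar> \<le> 5 * 10 powi (-7)"
    by (intro abs_leI) (simp_all add: power_int_minus)
  have "(\<lambda>n. (real n)\<^sup>2 / 4 * T n) \<longlonglongrightarrow> u"
    using T u by (intro tendsto_scaled_first_zero) auto
  then have "(\<lambda>n. 2 * sqrt ((real n)\<^sup>2 / 4 * T n)) \<longlonglongrightarrow> j"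
    unfolding j_def by (intro tendsto_intros)
  then have "(\<lambda>n. ereal (2 * sqrt ((real n)\<^sup>2 / 4 * T n))) \<longlonglongrightarrow> ereal j"
    by simp
  \<comment> \<open>The radius formula starts at n = 4, hence equality only eventually.\<close>
  moreover have "\<forall>\<^sub>F n in sequentially. ereal (2 * sqrt ((real n)\<^sup>2 / 4 * T n)) = ereal (real n) * max_radius n"
    using eventually_ge_at_top[of 4]
    by eventually_elim (simp add: radius real_sqrt_mult real_sqrt_divide)
  ultimately have lim: "(\<lambda>n. ereal (real n) * max_radius n) \<longlonglongrightarrow> ereal j"
    by (rule Lim_transform_eventually)
  have "\<exists>\<mu>. is_smallest_zero_ne_neg1 (hypergeo_poly n) \<mu> \<and> max_radius n = ereal (sqrt (1 + \<mu>))" if "n \<ge> 4" for n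
    using zeros[OF that] radius[OF that] by (intro exI[of _ "T n - 1"]) simp
  then show ?thesis
    using max_radius_2 max_radius_3 first bound lim by blast
qed

end
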